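(* Let $\Phi$ be a root system of type $D_\ell$ with $\ell\ge5$ odd, $j\in\{\ell-1,\ell\}$ and $\omega=\omega_j$. Then the set $\Phi_{\omega,0}^+=\{\beta\in\Phi^+:\beta^\omega=0\}$ is $$\Phi_{\omega,0}^+=\{e_1\pm e_{\frac{\ell+1}2},\ e_{\frac{\ell+1}2}\pm e_\ell,\ e_1\pm e_\ell\}\sqcup\{e_i+e_{\ell-i+1}: i\in\{2,\dots,\tfrac{\ell-1}2\}\},$$ that is, $\Phi_{\omega,0}^+$ is the disjoint union of $$\{\alpha_1+\cdots+\alpha_{\frac{\ell-1}2}\},\quad \{\alpha_{\frac{\ell+1}2}+\cdots+\alpha_{\ell-2}+\alpha_p: p\in\{\ell-1,\ell\}\},\quad \{\alpha_1+\cdots+\alpha_{\ell-2}+\alpha_p: p\in\{\ell-1,\ell\}\},$$ $$\{\alpha_{i_1}+\cdots+\alpha_{\ell-i_1}+2\alpha_{\ell-i_1+1}+\cdots+2\alpha_{\ell-2}+\alpha_{\ell-1}+\alpha_\ell: i_1\in\{2,\dots,\tfrac{\ell-1}2\}\},$$ $$\{\alpha_1+\cdots+\alpha_{\frac{\ell-1}2}+2\alpha_{\frac{\ell+1}2}+\cdots+2\alpha_{\ell-2}+\alpha_{\ell-1}+\alpha_\ell\}.$$ Hence $P(0)=\{\pm1,\pm2,\pm3\}$.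
   Context: Realize $\Phi$ of type $D_\ell$ in $E=\mathbb{R}^\ell$ with standard basis $e_1,\dots,e_\ell$ as $\{\pm e_p\pm e_q:p<q\}$, with basis $\Delta$: $\alpha_i=e_i-e_{i+1}$ ($1\le i\le\ell-1$), $\alpha_\ell=e_{\ell-1}+e_\ell$; $\Phi^+$ is the corresponding set of positive roots. Empty ranges in sums of simple roots contribute $0$. Let $\tilde\alpha=\sum_{i=1}^\ell n_i\alpha_i$ be the highest root, $\alpha_0=-\tilde\alpha$, $n_0=1$; then $J=\{i\in\{0,\dots,\ell\}:n_i=1\}=\{0,1,\ell-1,\ell\}$. For $j\in\{\ell-1,\ell\}$ let $w_j$ be the longest element of the subgroup of the Weyl group $W$ generated by the $s_{\alpha_i}$, $i\in\{1,\dots,\ell\}\setminus\{j\}$, let $w_0$ be the longest element of $W$, and $\omega_j=w_jw_0$; it acts on $\{\alpha_0,\dots,\alpha_\ell\}$ by an index permutation $\sigma_j$, where for $\ell$ odd $\sigma_\ell=(0\ \ \ell\ \ 1\ \ \ell-1)\prod_{i=2}^{(\ell-1)/2}(i\ \ \ell-i)$ and $\sigma_{\ell-1}=\sigma_\ell^{-1}$. Put $x^\omega=\frac1{o(\omega)}\sum_{t=1}^{o(\omega)}\omega^t(x)$ with $o(\omega)=4$ the order of $\omega=\omega_j$. Let $\varpi_1^\vee,\dots,\varpi_\ell^\vee$ be the dual basis of $\Delta$, $\varpi_0^\vee=0$, and $\pi_0^j=\varpi_0^\vee+\varpi_1^\vee+\varpi_{\ell-1}^\vee+\varpi_\ell^\vee$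 the sum over the $\langle\sigma_j\rangle$-orbit of $0$. Put $P(0)=\{(\gamma,\pi_0^j):\gamma\in\Phi,\ \gamma^\omega=0\}$. *)

theory Defs
  imports
    "HOL-Analysis.Analysis"
    "HOL-Algebra.Bij"
    "HOL-Algebra.Generated_Groups"
    "HOL-Algebra.Multiplicative_Group"
    "HOL-Combinatorics.Orbits"
begin

text \<open>
  Throughout, \<open>e :: nat \<Rightarrow> 'a\<close> is meant to enumerate the standard basis of the Euclidean space
  \<open>'a\<close> as \<open>e 1, \<dots>, e l\<close>, i.e. \<open>bij_betw e {1..l} Basis\<close>; in particular \<open>'a\<close> has dimension \<open>l\<close>.
\<close>

definition D_roots :: "nat \<Rightarrow> (nat \<Rightarrow> 'a::euclidean_space) \<Rightarrow> 'a set" where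
  "D_roots l e = {a *\<^sub>R e p + b *\<^sub>R e q | a b p q.
     a \<in> {1, -1} \<and> b \<in> {1, -1} \<and> 1 \<le> p \<and> p < q \<and> q \<le> l}"

definition D_simple :: "nat \<Rightarrow> (nat \<Rightarrow> 'a::euclidean_space) \<Rightarrow> nat \<Rightarrow> 'a" where
  "D_simple l e i = (if i = l then e (l - 1) + e l else e i - e (i + 1))"

definition D_cone :: "nat \<Rightarrow> (nat \<Rightarrow> 'a::euclidean_space) \<Rightarrow> 'a set" where
  "D_cone l e = {\<Sum>i = 1..l. real (c i) *\<^sub>R D_simple l e i | c :: nat \<Rightarrow> nat. True}"

definition D_pos_roots :: "nat \<Rightarrow> (nat \<Rightarrow> 'a::euclidean_space) \<Rightarrow> 'a set" where
  "D_pos_roots l e = D_roots l e \<inter> D_cone l e"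

definition D_highest :: "nat \<Rightarrow> (nat \<Rightarrow> 'a::euclidean_space) \<Rightarrow> 'a" where
  "D_highest l e = (THE \<theta>. \<theta> \<in> D_roots l e \<and> (\<forall>\<beta>\<in>D_roots l e. \<theta> - \<beta> \<in> D_cone l e))"

definition D_affine_simple :: "nat \<Rightarrow> (nat \<Rightarrow> 'a::euclidean_space) \<Rightarrow> nat \<Rightarrow> 'a" where
  "D_affine_simple l e i = (if i = 0 then - D_highest l e else D_simple l e i)"

definition reflection :: "'a::real_inner \<Rightarrow> 'a \<Rightarrow> 'a" where
  "reflection a x = x - (2 * (x \<bullet> a) / (a \<bullet> a)) *\<^sub>R a"

definition D_weyl :: "nat \<Rightarrow> (nat \<Rightarrow> 'a::euclidean_space) \<Rightarrow> ('a \<Rightarrow> 'a) set" where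
  "D_weyl l e = generate (BijGroup UNIV) (reflection ` D_roots l e)"

definition D_parabolic :: "nat \<Rightarrow> (nat \<Rightarrow> 'a::euclidean_space) \<Rightarrow> nat \<Rightarrow> ('a \<Rightarrow> 'a) set" where
  "D_parabolic l e j =
     generate (BijGroup UNIV) ((\<lambda>i. reflection (D_simple l e i)) ` ({1..l} - {j}))"

definition D_length :: "nat \<Rightarrow> (nat \<Rightarrow> 'a::euclidean_space) \<Rightarrow> ('a \<Rightarrow> 'a) \<Rightarrow> nat" where
  "D_length l e w = (LEAST n. \<exists>is. length is = n \<and> set is \<subseteq> {1..l} \<and>
     w = foldr (\<circ>) (map (\<lambda>i. reflection (D_simple l e i)) is) id)"

definition D_longest :: "nat \<Rightarrow> (nat \<Rightarrow> 'a::euclidean_space) \<Rightarrow> ('a \<Rightarrow> 'a) set \<Rightarrow> 'a \<Rightarrow> 'a" where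
  "D_longest l e X = (THE w. is_arg_max (D_length l e) (\<lambda>w. w \<in> X) w)"

definition D_omega :: "nat \<Rightarrow> (nat \<Rightarrow> 'a::euclidean_space) \<Rightarrow> nat \<Rightarrow> 'a \<Rightarrow> 'a" where
  "D_omega l e j = D_longest l e (D_parabolic l e j) \<circ> D_longest l e (D_weyl l e)"

text \<open>The projection \<open>x \<mapsto> x\<^sup>\<omega>\<close>, with \<open>o(\<omega>)\<close> the order of \<open>\<omega>\<close> in the group of bijections.\<close>

definition omega_avg :: "('a \<Rightarrow> 'a) \<Rightarrow> 'a::euclidean_space \<Rightarrow> 'a" where
  "omega_avg \<omega> x = (1 / real (group.ord (BijGroup UNIV) \<omega>)) *\<^sub>R
     (\<Sum>t = 1..group.ord (BijGroup UNIV) \<omega>. (\<omega> ^^ t) x)"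

definition D_pos_zero :: "nat \<Rightarrow> (nat \<Rightarrow> 'a::euclidean_space) \<Rightarrow> nat \<Rightarrow> 'a set" where
  "D_pos_zero l e j = {\<beta> \<in> D_pos_roots l e. omega_avg (D_omega l e j) \<beta> = 0}"

text \<open>The index permutation \<open>\<sigma>\<^sub>j\<close> of \<open>{0..l}\<close>, extended by the identity.\<close>

definition D_sigma :: "nat \<Rightarrow> (nat \<Rightarrow> 'a::euclidean_space) \<Rightarrow> nat \<Rightarrow> nat \<Rightarrow> nat" where
  "D_sigma l e j i = (if i \<le> l
     then THE k. k \<le> l \<and> D_omega l e j (D_affine_simple l e i) = D_affine_simple l e k
     else i)"

definition D_coweight :: "nat \<Rightarrow> (nat \<Rightarrow> 'a::euclidean_space) \<Rightarrow> nat \<Rightarrow> 'a" where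
  "D_coweight l e i = (if i = 0 then 0
     else THE v. \<forall>k\<in>{1..l}. D_simple l e k \<bullet> v = (if k = i then 1 else 0))"

definition D_pi0 :: "nat \<Rightarrow> (nat \<Rightarrow> 'a::euclidean_space) \<Rightarrow> nat \<Rightarrow> 'a" where
  "D_pi0 l e j = (\<Sum>i\<in>orbit (D_sigma l e j) 0. D_coweight l e i)"

definition D_P0 :: "nat \<Rightarrow> (nat \<Rightarrow> 'a::euclidean_space) \<Rightarrow> nat \<Rightarrow> real set" where
  "D_P0 l e j = {\<gamma> \<bullet> D_pi0 l e j | \<gamma>. \<gamma> \<in> D_roots l e \<and> omega_avg (D_omega l e j) \<gamma> = 0}"

definition is_disjoint_union :: "'b set \<Rightarrow> 'b set list \<Rightarrow> bool" where
  "is_disjoint_union S As \<longleftrightarrow>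
     S = \<Union>(set As) \<and> disjoint_family_on ((!) As) {..<length As}"

end

theory Submission
  imports Defs
begin

text \<open>
  The Weyl group of type \<open>D\<^sub>l\<close> acts on the coordinates by even signed permutations. For odd \<open>l\<close> the
  map \<open>-1\<close> changes an odd number of signs, and the longest element \<open>w\<^sub>0\<close> is \<open>-1\<close> followed by the
  sign change of \<open>e l\<close>. Put \<open>f i = e i\<close> for \<open>i < l\<close> and \<open>f l = \<eta> e l\<close>, with \<open>\<eta> = 1\<close> for \<open>j = l\<close> and
  \<open>\<eta> = -1\<close> for \<open>j = l - 1\<close>. The simple roots other than \<open>\<alpha>\<^sub>j\<close> are the differences \<open>f k - f (k + 1)\<close>,
  so the parabolic subgroup is the symmetric group on the vectors \<open>f i\<close> and its longest element
  reverses their order. Hence \<open>\<omega>\<close> sends \<open>f l\<close> to \<open>f 1\<close> and \<open>f i\<close> to \<open>- f (l + 1 - i)\<close> for \<open>i < l\<close>.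

  It has order four. The average over its powers kills \<open>e 1\<close> and \<open>e l\<close>, on which \<open>\<omega>\<close> is a rotation
  by a right angle, and maps \<open>e i\<close> to \<open>(e i - e (l + 1 - i)) / 2\<close> for \<open>1 < i < l\<close>. So \<open>\<beta>\<^sup>\<omega> = 0\<close> means
  that the coordinates of \<open>\<beta>\<close> at \<open>i\<close> and \<open>l + 1 - i\<close> agree for all these \<open>i\<close>
  (\<open>omega_avg_eq_0_iff\<close>). A root has two nonzero coordinates: either both are at places in
  \<open>{1, m, l}\<close>, where \<open>m = (l + 1) / 2\<close>, or they are equal and at places exchanged by
  \<open>i \<mapsto> l + 1 - i\<close>. That gives the list of positive roots (\<open>pos_zero_eq\<close>). The affine node \<open>0\<close> runs
  through \<open>0, 1, l - 1, l\<close>, and the sum of the corresponding coweights is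
  \<open>2 e 1 + e 2 + \<dots> + e (l - 1)\<close>, whose inner products with the listed roots are \<open>1\<close>, \<open>2\<close> and \<open>3\<close>
  (\<open>P0_eq\<close>).

  The longest elements are defined through word length, so the formulas for them need the
  combinatorics of lengths. Positivity of a root is read off from its height, the inner product
  with a vector \<open>\<rho>\<close>. Composing \<open>w\<close> with a simple reflection changes the number of positive roots
  that \<open>w\<close> makes negative by exactly one (\<open>card_inversions_comp_s\<close>), and an even signed permutation
  that keeps all simple roots positive is the identity (\<open>even_signed_perm_positive_id\<close>). So this
  number is the length, and every even signed permutation is a product of simple reflections. An
  element of maximal length in a subgroup generated by simple reflections must then make all the
  corresponding simple roots negative (\<open>longest_unique\<close>), and this identifies it.
\<close>
section \<open>Groups generated by involutions\<close>

lemma BijGroup_UNIV_simps: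
  "carrier (BijGroup UNIV) = {f. bij f}"
  "\<one>\<^bsub>BijGroup UNIV\<^esub> = id"
  "bij f \<Longrightarrow> bij g \<Longrightarrow> f \<otimes>\<^bsub>BijGroup UNIV\<^esub> g = f \<circ> g"
  by (auto simp: BijGroup_def Bij_def compose_def fun_eq_iff)

lemma foldr_comp_Cons: "foldr (\<circ>) (x # xs) id = x \<circ> foldr (\<circ>) xs (id :: 'b \<Rightarrow> 'b)"
  by simp

lemma foldr_comp_append:
  "foldr (\<circ>) (xs @ ys) id = foldr (\<circ>) xs id \<circ> foldr (\<circ>) ys (id :: 'b \<Rightarrow> 'b)"
  by (induction xs) (auto simp: o_assoc)

text \<open>An involution is its own inverse, so inverses of generators add nothing to the words.\<close>

lemma generate_involutions:
  fixes S :: "('b \<Rightarrow> 'b) set"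
  assumes inv: "\<And>s. s \<in> S \<Longrightarrow> s \<circ> s = id"
  shows "generate (BijGroup UNIV) S = {foldr (\<circ>) ws id | ws. set ws \<subseteq> S}"
proof -
  interpret group "BijGroup (UNIV :: 'b set)" by (rule group_BijGroup)
  have bijS: "bij s" if "s \<in> S" for s using inv[OF that] by (rule o_bij[of s s]) (rule inv[OF that])
  have bijw: "bij (foldr (\<circ>) ws id)" if "set ws \<subseteq> S" for ws
    using that by (induction ws) (auto intro: bij_comp bijS)
  show ?thesis
  proof (intro equalityI subsetI)
    fix w assume "w \<in> generate (BijGroup UNIV) S"
    then show "w \<in> {foldr (\<circ>) ws id | ws. set ws \<subseteq> S}"
    proof induction
      case one
      have "\<one>\<^bsub>BijGroup UNIV\<^esub> = foldr (\<circ>) [] (id :: 'b \<Rightarrow> 'b)" by (simp add: BijGroup_UNIV_simps)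
      then show ?case by (metis (mono_tags, lifting) empty_set empty_subsetI mem_Collect_eq)
    next
      case (incl h)
      have "h = foldr (\<circ>) [h] id" by simp
      then show ?case using incl
        by (metis (mono_tags, lifting) empty_set empty_subsetI insert_subset list.simps(15) mem_Collect_eq)
    next
      case (inv h)
      have "inv\<^bsub>BijGroup UNIV\<^esub> h = h"
        using assms[OF inv] bijS[OF inv] by (intro inv_equality) (auto simp: BijGroup_UNIV_simps)
      also have "h = foldr (\<circ>) [h] id" by simp
      finally show ?case using inv
        by (metis (mono_tags, lifting) empty_set empty_subsetI insert_subset list.simps(15) mem_Collect_eq)
    next
      case (eng g h)
      then obtain us vs where us: "g = foldr (\<circ>) us id" "set us \<subseteq> S"
        and vs: "h = foldr (\<circ>) vs id" "set vs \<subseteq> S" by blast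
      have "g \<otimes>\<^bsub>BijGroup UNIV\<^esub> h = foldr (\<circ>) (us @ vs) id"
        using us vs bijw[of us] bijw[of vs] unfolding foldr_comp_append
        by (simp only: BijGroup_UNIV_simps)
      moreover have "set (us @ vs) \<subseteq> S" using us vs by simp
      ultimately show ?case by blast
    qed
  next
    fix w assume "w \<in> {foldr (\<circ>) ws id | ws. set ws \<subseteq> S}"
    then obtain ws where w: "w = foldr (\<circ>) ws id" and "set ws \<subseteq> S" by blast
    from this(2) have "foldr (\<circ>) ws id \<in> generate (BijGroup UNIV) S"
    proof (induction ws)
      case Nil
      then show ?case using generate.one[of "BijGroup UNIV" S] by (simp add: BijGroup_UNIV_simps id_def)
    next
      case (Cons s ws)
      have "foldr (\<circ>) ws id \<in> generate (BijGroup UNIV) S"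
        by (rule Cons.IH) (use Cons.prems in auto)
      then have "s \<otimes>\<^bsub>BijGroup UNIV\<^esub> foldr (\<circ>) ws id \<in> generate (BijGroup UNIV) S"
        using Cons.prems by (intro generate.eng[OF generate.incl]) auto
      moreover have "s \<otimes>\<^bsub>BijGroup UNIV\<^esub> foldr (\<circ>) ws id = s \<circ> foldr (\<circ>) ws id"
        using Cons.prems by (intro BijGroup_UNIV_simps bijS bijw) auto
      ultimately show ?case by (simp only: foldr_comp_Cons)
    qed
    then show "w \<in> generate (BijGroup UNIV) S" using w by simp
  qed
qed

section \<open>Orthonormal frames and reflections\<close>

text \<open>The vectors of a frame need not belong to \<open>Basis\<close>: for the node \<open>l - 1\<close> the parabolic subgroup
  permutes a frame in which the last basis vector is negated.\<close>
locale orthonormal_frame =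
  fixes l :: nat and e :: "nat \<Rightarrow> 'a::euclidean_space"
  assumes inner_frame: "i \<in> {1..l} \<Longrightarrow> k \<in> {1..l} \<Longrightarrow> e i \<bullet> e k = (if i = k then 1 else 0)"
    and frame_expansion: "(\<Sum>i = 1..l. (x \<bullet> e i) *\<^sub>R e i) = x"
begin

lemma frame_eqI: "x = y" if "\<And>i. i \<in> {1..l} \<Longrightarrow> x \<bullet> e i = y \<bullet> e i"
  using that frame_expansion[of x] frame_expansion[of y] by (metis (no_types, lifting) sum.cong)

lemma frame_linear_eqI:
  fixes v w :: "'a \<Rightarrow> 'a"
  assumes "linear v" "linear w" "\<And>i. i \<in> {1..l} \<Longrightarrow> v (e i) = w (e i)"
  shows "v = w"
proof
  fix x
  have "u x = (\<Sum>i = 1..l. (x \<bullet> e i) *\<^sub>R u (e i))" if "linear u" for u :: "'a \<Rightarrow> 'a"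
    using linear_sum[OF that, of "\<lambda>i. (x \<bullet> e i) *\<^sub>R e i" "{1..l}"]
    unfolding frame_expansion by (simp add: linear_cmul[OF that])
  from this[of v] this[of w] show "v x = w x" using assms by simp
qed

end

lemma linear_reflection: "linear (reflection a)"
  by (rule linearI) (auto simp: reflection_def inner_add_left algebra_simps add_divide_distrib)

lemma reflection_involution: "reflection a \<circ> reflection a = id"
  by (auto simp: fun_eq_iff reflection_def inner_diff_left algebra_simps)

context orthonormal_frame
begin

lemma inner_frame_pair:
  assumes "p \<in> {1..l}" "q \<in> {1..l}" "p \<noteq> q" "a \<in> {1, -1}" "b \<in> {1, -1::real}"
  shows "(a *\<^sub>R e p + b *\<^sub>R e q) \<bullet> (a *\<^sub>R e p + b *\<^sub>R e q) = 2"
  using assms by (auto simp: inner_add_left inner_add_right inner_frame)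

lemma reflection_frame_pair:
  assumes "p \<in> {1..l}" "q \<in> {1..l}" "p \<noteq> q" "a \<in> {1, -1}" "b \<in> {1, -1::real}" "i \<in> {1..l}"
  shows "reflection (a *\<^sub>R e p + b *\<^sub>R e q) (e i) =
    (if i \<in> {p, q} then - (a * b) else 1) *\<^sub>R e (Transposition.transpose p q i)"
  using assms inner_frame_pair[OF assms(1-5)]
  by (auto simp: reflection_def inner_add_right inner_frame Transposition.transpose_def algebra_simps)

end

section \<open>Roots, heights and positive roots\<close>

locale D_frame = orthonormal_frame l e for l :: nat and e :: "nat \<Rightarrow> 'a::euclidean_space" +
  assumes l_ge_3: "l \<ge> 3"
begin

abbreviation \<alpha> :: "nat \<Rightarrow> 'a" where "\<alpha> \<equiv> D_simple l e"
abbreviation \<Phi> :: "'a set" where "\<Phi> \<equiv> D_roots l e"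
abbreviation s :: "nat \<Rightarrow> 'a \<Rightarrow> 'a" where "s i \<equiv> reflection (\<alpha> i)"

text \<open>Half the sum of the positive roots. Every simple root has inner product one with it, so on the
  root lattice \<open>ht\<close> is the height with respect to the simple roots.\<close>
definition \<rho> :: 'a where "\<rho> = (\<Sum>i = 1..l. (real l - real i) *\<^sub>R e i)"

definition ht :: "'a \<Rightarrow> real" where "ht x = x \<bullet> \<rho>"

lemma ht_frame: "i \<in> {1..l} \<Longrightarrow> ht (e i) = real l - real i"
  by (simp add: ht_def \<rho>_def inner_sum_right inner_frame if_distrib sum.delta' cong: if_cong)

lemma ht_linear [simp]:
  "ht (x + y) = ht x + ht y" "ht (x - y) = ht x - ht y" "ht (- x) = - ht x"
  "ht (c *\<^sub>R x) = c * ht x" "ht 0 = 0"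
  by (auto simp: ht_def inner_add_left inner_diff_left)

lemma ht_sum: "ht (\<Sum>i\<in>A. f i) = (\<Sum>i\<in>A. ht (f i))"
  by (simp add: ht_def inner_sum_left)

lemma rootI:
  assumes "a \<in> {1, -1}" "b \<in> {1, -1}" "p \<in> {1..l}" "q \<in> {1..l}" "p \<noteq> q"
  shows "a *\<^sub>R e p + b *\<^sub>R e q \<in> \<Phi>"
proof -
  have ordered: "a *\<^sub>R e p + b *\<^sub>R e q \<in> \<Phi>"
    if "a \<in> {1, -1}" "b \<in> {1, -1}" "1 \<le> p" "p < q" "q \<le> l" for a b p q
    unfolding D_roots_def by (rule CollectI) (intro exI conjI, rule refl, use that in auto)
  show ?thesis
    using ordered[of a b p q] ordered[of b a q p] assms by (cases "p < q") (auto simp: add.commute)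
qed

lemma rootE:
  assumes "\<beta> \<in> \<Phi>"
  obtains a b p q where "a \<in> {1, -1}" "b \<in> {1, -1}" "p \<in> {1..l}" "q \<in> {1..l}" "p < q"
    "\<beta> = a *\<^sub>R e p + b *\<^sub>R e q"
proof -
  from assms obtain a b p q where "\<beta> = a *\<^sub>R e p + b *\<^sub>R e q" "a \<in> {1, -1}" "b \<in> {1, -1}"
    "1 \<le> p" "p < q" "q \<le> l"
    unfolding D_roots_def by blast
  then show ?thesis by (intro that) auto
qed

lemma finite_roots: "finite \<Phi>"
proof (rule finite_subset)
  show "\<Phi> \<subseteq> (\<lambda>(a, b, p, q). a *\<^sub>R e p + b *\<^sub>R e q) ` ({1, -1} \<times> {1, -1} \<times> {1..l} \<times> {1..l})"
  proof
    fix \<beta> assume "\<beta> \<in> \<Phi>"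
    then obtain a b p q where "a \<in> {1, -1}" "b \<in> {1, -1}" "p \<in> {1..l}" "q \<in> {1..l}" "p < q"
      "\<beta> = a *\<^sub>R e p + b *\<^sub>R e q" by (rule rootE) blast
    then show "\<beta> \<in> (\<lambda>(a, b, p, q). a *\<^sub>R e p + b *\<^sub>R e q) ` ({1, -1} \<times> {1, -1} \<times> {1..l} \<times> {1..l})"
      by (intro image_eqI[where x = "(a, b, p, q)"]) auto
  qed
qed auto

lemma ht_root_int: "\<beta> \<in> \<Phi> \<Longrightarrow> ht \<beta> \<in> \<int>"
  by (erule rootE) (auto simp: ht_frame)

lemma ht_root_nz: "\<beta> \<in> \<Phi> \<Longrightarrow> ht \<beta> \<noteq> 0"
  by (erule rootE) (auto simp: ht_frame)

lemma uminus_root: "\<beta> \<in> \<Phi> \<Longrightarrow> - \<beta> \<in> \<Phi>"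
proof (erule rootE)
  fix a b p q assume "a \<in> {1, -1}" "b \<in> {1, -1}" "p \<in> {1..l}" "q \<in> {1..l}" "p < q"
    "\<beta> = a *\<^sub>R e p + b *\<^sub>R e q"
  then show "- \<beta> \<in> \<Phi>" using rootI[of "- a" "- b" p q] by auto
qed

lemma root_norm: "\<beta> \<in> \<Phi> \<Longrightarrow> \<beta> \<bullet> \<beta> = 2"
proof (erule rootE)
  fix a b p q assume "a \<in> {1, -1}" "b \<in> {1, -1}" "p \<in> {1..l}" "q \<in> {1..l}" "p < q"
    "\<beta> = a *\<^sub>R e p + b *\<^sub>R e q"
  then show "\<beta> \<bullet> \<beta> = 2" using inner_frame_pair[of p q a b] by simp
qed

lemma simple_signed: "i \<in> {1..l} \<Longrightarrow>
  \<alpha> i = (if i = l then 1 *\<^sub>R e (l - 1) + 1 *\<^sub>R e l else 1 *\<^sub>R e i + (-1) *\<^sub>R e (i + 1))"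
  by (simp add: D_simple_def)

lemma simple_root: "i \<in> {1..l} \<Longrightarrow> \<alpha> i \<in> \<Phi>"
  using l_ge_3 rootI[of 1 1 "l - 1" l] rootI[of 1 "-1" i "i + 1"]
  by (subst simple_signed) auto

lemma ht_simple: "i \<in> {1..l} \<Longrightarrow> ht (\<alpha> i) = 1"
  using l_ge_3 by (auto simp: D_simple_def ht_frame)

lemma cone_zero: "0 \<in> D_cone l e"
  unfolding D_cone_def by (rule CollectI, rule exI[of _ "\<lambda>_. 0"]) auto

lemma cone_simple: "k \<in> {1..l} \<Longrightarrow> \<alpha> k \<in> D_cone l e"
  unfolding D_cone_def
  by (rule CollectI, rule exI[of _ "\<lambda>i. if i = k then 1 else 0"])
     (simp add: if_distrib[of real] if_distrib[of "\<lambda>c. c *\<^sub>R _"] sum.delta' cong: if_cong)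

lemma cone_add: "x \<in> D_cone l e \<Longrightarrow> y \<in> D_cone l e \<Longrightarrow> x + y \<in> D_cone l e"
  unfolding D_cone_def
proof clarify
  fix c d :: "nat \<Rightarrow> nat"
  show "\<exists>b. (\<Sum>i = 1..l. real (c i) *\<^sub>R \<alpha> i) + (\<Sum>i = 1..l. real (d i) *\<^sub>R \<alpha> i) =
      (\<Sum>i = 1..l. real (b i) *\<^sub>R \<alpha> i) \<and> True"
    by (rule exI[of _ "\<lambda>i. c i + d i"]) (simp add: scaleR_add_left sum.distrib)
qed

lemma cone_minus: "p \<le> q \<Longrightarrow> 1 \<le> p \<Longrightarrow> q \<le> l \<Longrightarrow> e p - e q \<in> D_cone l e"
proof (induction q rule: dec_induct)
  case base
  then show ?case by (simp add: cone_zero)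
next
  case (step n)
  have "e p - e (Suc n) = (e p - e n) + \<alpha> n" using step by (simp add: D_simple_def)
  moreover have "e p - e n \<in> D_cone l e" "\<alpha> n \<in> D_cone l e"
    using step by (auto intro!: cone_simple)
  ultimately show ?case by (simp only: cone_add)
qed

text \<open>The hypothesis \<open>p < l\<close> excludes \<open>2 e l\<close>, which is \<open>\<alpha> l - \<alpha> (l - 1)\<close>. The case \<open>p = q\<close> is not a
  root but occurs in the proof that \<open>e 1 + e 2\<close> dominates all roots.\<close>
lemma cone_plus:
  assumes "1 \<le> p" "p < l" "1 \<le> q" "q \<le> l"
  shows "e p + e q \<in> D_cone l e"
proof -
  have "e p + e q = (e p - e (l - 1)) + ((e q - e l) + \<alpha> l)"
    by (simp add: D_simple_def)
  also have "\<dots> \<in> D_cone l e" using assms by (intro cone_add cone_minus cone_simple) auto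
  finally show ?thesis .
qed

lemma cone_ht:
  assumes "x \<in> D_cone l e"
  shows "ht x \<ge> 0" "ht x = 0 \<Longrightarrow> x = 0"
proof -
  obtain c :: "nat \<Rightarrow> nat" where x: "x = (\<Sum>i = 1..l. real (c i) *\<^sub>R \<alpha> i)"
    using assms unfolding D_cone_def by auto
  have h: "ht x = (\<Sum>i = 1..l. real (c i))"
    by (simp add: x ht_sum ht_simple)
  show "ht x \<ge> 0" by (simp add: h sum_nonneg)
  show "x = 0" if "ht x = 0"
  proof -
    have "\<forall>i\<in>{1..l}. real (c i) = 0"
      using that unfolding h by (subst (asm) sum_nonneg_eq_0_iff) auto
    then show ?thesis unfolding x by simp
  qed
qed

lemma pos_root_cases:
  assumes "\<beta> \<in> \<Phi>" "ht \<beta> > 0"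
  obtains b p q where "b \<in> {1, -1}" "p \<in> {1..l}" "q \<in> {1..l}" "p < q" "\<beta> = e p + b *\<^sub>R e q"
proof -
  obtain a b p q where *: "a \<in> {1, -1}" "b \<in> {1, -1}" "p \<in> {1..l}" "q \<in> {1..l}" "p < q"
    "\<beta> = a *\<^sub>R e p + b *\<^sub>R e q" using assms(1) by (rule rootE) blast
  then have "a = 1" using assms(2) by (auto simp: ht_frame)
  then show ?thesis using * that by simp
qed

text \<open>A root in the cone has positive height because simple roots have height one and no root has
  height zero. Conversely the roots of positive height are the \<open>e p \<plusminus> e q\<close> with \<open>p < q\<close>, and these
  are sums of simple roots.\<close>
lemma pos_roots_eq: "D_pos_roots l e = {\<beta> \<in> \<Phi>. ht \<beta> > 0}"
proof (intro equalityI subsetI)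
  fix \<beta> assume "\<beta> \<in> D_pos_roots l e"
  then show "\<beta> \<in> {\<beta> \<in> \<Phi>. ht \<beta> > 0}"
    using cone_ht(1)[of \<beta>] ht_root_nz[of \<beta>] by (auto simp: D_pos_roots_def)
next
  fix \<beta> assume "\<beta> \<in> {\<beta> \<in> \<Phi>. ht \<beta> > 0}"
  then have \<beta>: "\<beta> \<in> \<Phi>" "ht \<beta> > 0" by auto
  then obtain b p q where "b \<in> {1, -1}" "p \<in> {1..l}" "q \<in> {1..l}" "p < q" "\<beta> = e p + b *\<^sub>R e q"
    by (rule pos_root_cases) blast
  then have "\<beta> \<in> D_cone l e" using cone_plus[of p q] cone_minus[of p q] by auto
  then show "\<beta> \<in> D_pos_roots l e" using \<beta> by (simp add: D_pos_roots_def)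
qed

text \<open>For a root \<open>\<beta> = a e p + b e q\<close> with \<open>p < q\<close>, the vectors \<open>e 1 - a e p\<close> and \<open>e 2 - b e q\<close> are both in
  the cone, so \<open>e 1 + e 2\<close> dominates \<open>\<beta>\<close>. Two such roots differ by a vector that is in the cone
  together with its negative, which has height zero and so vanishes.\<close>
lemma highest_root: "D_highest l e = e 1 + e 2"
  unfolding D_highest_def
proof (rule the_equality)
  have dom: "e 1 + e 2 - \<beta> \<in> D_cone l e" if "\<beta> \<in> \<Phi>" for \<beta>
  proof -
    obtain a b p q where *: "a \<in> {1, -1}" "b \<in> {1, -1}" "p \<in> {1..l}" "q \<in> {1..l}" "p < q"
      "\<beta> = a *\<^sub>R e p + b *\<^sub>R e q" using \<open>\<beta> \<in> \<Phi>\<close> by (rule rootE) blast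
    then have "e 1 - a *\<^sub>R e p \<in> D_cone l e" "e 2 - b *\<^sub>R e q \<in> D_cone l e"
      using cone_plus[of 1 p] cone_minus[of 1 p] cone_plus[of 2 q] cone_minus[of 2 q] l_ge_3 by auto
    from cone_add[OF this] show ?thesis using * by (simp add: algebra_simps)
  qed
  then show *: "e 1 + e 2 \<in> \<Phi> \<and> (\<forall>\<beta>\<in>\<Phi>. e 1 + e 2 - \<beta> \<in> D_cone l e)"
    using rootI[of 1 1 1 2] l_ge_3 by auto
  fix \<theta> assume \<theta>: "\<theta> \<in> \<Phi> \<and> (\<forall>\<beta>\<in>\<Phi>. \<theta> - \<beta> \<in> D_cone l e)"
  then have 1: "\<theta> - (e 1 + e 2) \<in> D_cone l e" and 2: "e 1 + e 2 - \<theta> \<in> D_cone l e"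
    using * by auto
  have "ht (\<theta> - (e 1 + e 2)) = 0" using cone_ht(1)[OF 1] cone_ht(1)[OF 2] by simp
  then have "\<theta> - (e 1 + e 2) = 0" by (rule cone_ht(2)[OF 1])
  then show "\<theta> = e 1 + e 2" by simp
qed

section \<open>Even signed permutations\<close>

text \<open>The product condition excludes \<open>e l \<mapsto> - e l\<close>. That sign change exchanges the simple roots
  \<open>\<alpha> (l - 1)\<close> and \<open>\<alpha> l\<close>, so it keeps all positive roots positive without being the identity.\<close>
definition even_signed_perms :: "('a \<Rightarrow> 'a) set" where
  "even_signed_perms = {w. linear w \<and> (\<exists>\<pi> \<epsilon>. \<pi> permutes {1..l} \<and>
     (\<forall>i\<in>{1..l}. \<epsilon> i \<in> {1, -1} \<and> w (e i) = \<epsilon> i *\<^sub>R e (\<pi> i)) \<and> (\<Prod>i = 1..l. \<epsilon> i) = (1::real))}"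

lemma even_signed_permsE:
  assumes "w \<in> even_signed_perms"
  obtains \<pi> \<epsilon> where "linear w" "\<pi> permutes {1..l}" "\<And>i. i \<in> {1..l} \<Longrightarrow> \<epsilon> i \<in> {1, -1::real}"
    "\<And>i. i \<in> {1..l} \<Longrightarrow> w (e i) = \<epsilon> i *\<^sub>R e (\<pi> i)" "(\<Prod>i = 1..l. \<epsilon> i) = 1"
  using assms unfolding even_signed_perms_def mem_Collect_eq by blast

lemma even_signed_permsI:
  assumes "linear w" "\<pi> permutes {1..l}" "\<And>i. i \<in> {1..l} \<Longrightarrow> \<epsilon> i \<in> {1, -1::real}"
    "\<And>i. i \<in> {1..l} \<Longrightarrow> w (e i) = \<epsilon> i *\<^sub>R e (\<pi> i)" "(\<Prod>i = 1..l. \<epsilon> i) = 1"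
  shows "w \<in> even_signed_perms"
  unfolding even_signed_perms_def
  by (intro CollectI conjI exI[of _ \<pi>] exI[of _ \<epsilon>] ballI assms)

lemma even_signed_perm_id: "id \<in> even_signed_perms"
  by (rule even_signed_permsI[of _ id "\<lambda>_. 1"]) (auto simp: linear_id permutes_id)

lemma even_signed_perm_comp:
  assumes "v \<in> even_signed_perms" "w \<in> even_signed_perms"
  shows "v \<circ> w \<in> even_signed_perms"
proof -
  obtain \<pi> \<epsilon> where v: "linear v" "\<pi> permutes {1..l}" "\<And>i. i \<in> {1..l} \<Longrightarrow> \<epsilon> i \<in> {1, -1::real}"
    "\<And>i. i \<in> {1..l} \<Longrightarrow> v (e i) = \<epsilon> i *\<^sub>R e (\<pi> i)" "(\<Prod>i = 1..l. \<epsilon> i) = 1"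
    using assms(1) by (rule even_signed_permsE) blast
  obtain \<pi>' \<epsilon>' where w: "linear w" "\<pi>' permutes {1..l}" "\<And>i. i \<in> {1..l} \<Longrightarrow> \<epsilon>' i \<in> {1, -1::real}"
    "\<And>i. i \<in> {1..l} \<Longrightarrow> w (e i) = \<epsilon>' i *\<^sub>R e (\<pi>' i)" "(\<Prod>i = 1..l. \<epsilon>' i) = 1"
    using assms(2) by (rule even_signed_permsE) blast
  have in_range: "\<pi>' i \<in> {1..l}" if "i \<in> {1..l}" for i
    using permutes_in_image[OF w(2)] that by blast
  have "(\<Prod>i = 1..l. \<epsilon>' i * \<epsilon> (\<pi>' i)) = 1"
    using v(5) w(5) prod.permute[OF w(2), of \<epsilon>] by (simp add: prod.distrib)
  moreover have "\<epsilon>' i * \<epsilon> (\<pi>' i) \<in> {1, -1}" "(v \<circ> w) (e i) = (\<epsilon>' i * \<epsilon> (\<pi>' i)) *\<^sub>R e ((\<pi> \<circ> \<pi>') i)"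
    if "i \<in> {1..l}" for i
    using v(3)[OF in_range[OF that]] w(3)[OF that] v(4)[OF in_range[OF that]] w(4)[OF that]
      linear_cmul[OF v(1)] by auto
  ultimately show ?thesis
    using linear_compose[OF w(1) v(1)] permutes_compose[OF w(2) v(2)]
    by (intro even_signed_permsI[of _ "\<pi> \<circ> \<pi>'" "\<lambda>i. \<epsilon>' i * \<epsilon> (\<pi>' i)"])
qed

lemma even_signed_perm_reflection:
  assumes "\<beta> \<in> \<Phi>"
  shows "reflection \<beta> \<in> even_signed_perms"
proof -
  obtain a b p q where *: "a \<in> {1, -1}" "b \<in> {1, -1}" "p \<in> {1..l}" "q \<in> {1..l}" "p < q"
    "\<beta> = a *\<^sub>R e p + b *\<^sub>R e q" using assms by (rule rootE) blast
  define \<epsilon> where "\<epsilon> i = (if i \<in> {p, q} then - (a * b) else 1)" for i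
  have "(\<Prod>i = 1..l. \<epsilon> i) = (\<Prod>i\<in>{p, q}. \<epsilon> i)"
    by (rule prod.mono_neutral_right) (use * in \<open>auto simp: \<epsilon>_def\<close>)
  also have "\<dots> = 1" using * by (auto simp: \<epsilon>_def)
  finally have "(\<Prod>i = 1..l. \<epsilon> i) = 1" .
  moreover have "Transposition.transpose p q permutes {1..l}"
    using * by (intro permutes_swap_id) auto
  moreover have "\<epsilon> i \<in> {1, -1}" for i using * by (auto simp: \<epsilon>_def)
  moreover have "reflection \<beta> (e i) = \<epsilon> i *\<^sub>R e (Transposition.transpose p q i)" if "i \<in> {1..l}" for i
    unfolding *(6) \<epsilon>_def using reflection_frame_pair[of p q a b i] * that by auto
  ultimately show ?thesis
    by (intro even_signed_permsI[of _ "Transposition.transpose p q" \<epsilon>] linear_reflection)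
qed

lemma even_signed_perm_root:
  assumes "w \<in> even_signed_perms" "\<beta> \<in> \<Phi>"
  shows "w \<beta> \<in> \<Phi>"
proof -
  obtain a b p q where *: "a \<in> {1, -1}" "b \<in> {1, -1}" "p \<in> {1..l}" "q \<in> {1..l}" "p < q"
    "\<beta> = a *\<^sub>R e p + b *\<^sub>R e q" using assms(2) by (rule rootE) blast
  obtain \<pi> \<epsilon> where w: "linear w" "\<pi> permutes {1..l}" "\<And>i. i \<in> {1..l} \<Longrightarrow> \<epsilon> i \<in> {1, -1::real}"
    "\<And>i. i \<in> {1..l} \<Longrightarrow> w (e i) = \<epsilon> i *\<^sub>R e (\<pi> i)"
    using assms(1) by (rule even_signed_permsE) blast
  have "w \<beta> = (a * \<epsilon> p) *\<^sub>R e (\<pi> p) + (b * \<epsilon> q) *\<^sub>R e (\<pi> q)"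
    using * w by (simp add: linear_add linear_cmul)
  moreover have "\<pi> p \<noteq> \<pi> q" using permutes_inj[OF w(2)] *(5) by (metis injD less_irrefl)
  moreover have "\<pi> p \<in> {1..l}" "\<pi> q \<in> {1..l}" using permutes_in_image[OF w(2)] * by blast+
  ultimately show ?thesis using * w(3)[of p] w(3)[of q] by (auto intro!: rootI)
qed

lemma even_signed_perm_linear: "w \<in> even_signed_perms \<Longrightarrow> linear w"
  by (simp add: even_signed_perms_def)

end

text \<open>Upward induction from \<open>1\<close> gives \<open>k \<le> \<pi> k\<close>, downward induction from \<open>l\<close> gives \<open>\<pi> k \<le> k\<close>.\<close>
lemma strictly_increasing_self_map_id:
  fixes \<pi> :: "nat \<Rightarrow> nat"
  assumes range: "\<And>k. k \<in> {1..l} \<Longrightarrow> \<pi> k \<in> {1..l}" and incr: "\<And>i. 1 \<le> i \<Longrightarrow> i < l \<Longrightarrow> \<pi> i < \<pi> (Suc i)"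
    and i: "i \<in> {1..l}"
  shows "\<pi> i = i"
proof -
  have "k \<le> \<pi> k" if "1 \<le> k" "k \<le> l" for k
    using that
  proof (induction k rule: dec_induct)
    case base
    then show ?case using range[of 1] by simp
  next
    case (step n)
    then show ?case using incr[of n] by simp
  qed
  moreover have "\<pi> k \<le> k" if "k \<le> l" "1 \<le> k" for k
    using that
  proof (induction k rule: inc_induct)
    case base
    then show ?case using range[of l] by simp
  next
    case (step n)
    then show ?case using incr[of n] by simp
  qed
  ultimately show ?thesis using i by (simp add: order_antisym)
qed

context D_frame
begin

text \<open>Let \<open>A i\<close> be the height of \<open>v (e i)\<close>, which is \<open>\<plusminus> (l - \<pi> i)\<close>. Positivity on the simple roots says
  \<open>A 1 > \<dots> > A (l - 1) > \<bar>A l\<bar>\<close>. So all signs before the last one are positive and \<open>\<pi>\<close> is increasing,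
  hence the identity; the last sign is positive because the product of the signs is one.\<close>
lemma even_signed_perm_positive_id:
  assumes v: "v \<in> even_signed_perms" and pos: "\<And>i. i \<in> {1..l} \<Longrightarrow> ht (v (\<alpha> i)) > 0"
  shows "v = id"
proof -
  obtain \<pi> \<epsilon> where v: "linear v" "\<pi> permutes {1..l}" "\<And>i. i \<in> {1..l} \<Longrightarrow> \<epsilon> i \<in> {1, -1::real}"
    "\<And>i. i \<in> {1..l} \<Longrightarrow> v (e i) = \<epsilon> i *\<^sub>R e (\<pi> i)" "(\<Prod>i = 1..l. \<epsilon> i) = 1"
    using v by (rule even_signed_permsE) blast
  have range: "\<pi> k \<in> {1..l}" if "k \<in> {1..l}" for k using permutes_in_image[OF v(2)] that by blast
  define A where "A i = ht (v (e i))" for i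
  have A: "A i = \<epsilon> i * (real l - real (\<pi> i))" if "i \<in> {1..l}" for i
    using v(4)[OF that] ht_frame[OF range[OF that]] by (simp add: A_def)
  have decr: "A i > A (Suc i)" if "1 \<le> i" "i < l" for i
    using pos[of i] that by (simp add: A_def D_simple_def linear_diff[OF v(1)])
  have last: "A (l - 1) + A l > 0"
    using pos[of l] l_ge_3 by (simp add: A_def D_simple_def linear_add[OF v(1)])
  have A_pos: "A i > 0" if "i \<le> l - 1" "1 \<le> i" for i
    using that
  proof (induction i rule: inc_induct)
    case base
    then show ?case using last decr[of "l - 1"] l_ge_3 by simp
  next
    case (step n)
    then have "A n > A (Suc n)" by (intro decr) auto
    then show ?case using step by simp
  qed
  have \<epsilon>: "\<epsilon> i = 1" if "i \<in> {1..<l}" for i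
  proof -
    have "\<epsilon> i * (real l - real (\<pi> i)) > 0" using A[of i] A_pos[of i] that by auto
    moreover have "real (\<pi> i) \<le> real l" using range[of i] that by simp
    ultimately show ?thesis using v(3)[of i] that by (auto simp: zero_less_mult_iff)
  qed
  have incr: "\<pi> i < \<pi> (Suc i)" if "1 \<le> i" "i < l" for i
  proof (cases "Suc i = l")
    case True
    then have "i = l - 1" by simp
    then have "A i > A l" "A i + A l > 0" using decr[OF that] last True by simp_all
    moreover have "A i = real l - real (\<pi> i)" using A[of i] \<epsilon>[of i] that by simp
    moreover have "A l = real l - real (\<pi> l) \<or> A l = - (real l - real (\<pi> l))"
      using A[of l] v(3)[of l] l_ge_3 by auto
    ultimately have "real (\<pi> i) < real (\<pi> l)" by linarith
    then show ?thesis using True by simp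
  next
    case False
    then have "A i = real l - real (\<pi> i)" "A (Suc i) = real l - real (\<pi> (Suc i))"
      using A[of i] A[of "Suc i"] \<epsilon>[of i] \<epsilon>[of "Suc i"] that by simp_all
    then show ?thesis using decr[OF that] by simp
  qed
  have \<pi>: "\<pi> i = i" if "i \<in> {1..l}" for i
    using strictly_increasing_self_map_id[of l \<pi> i, OF range incr that] .
  have "{1..l} = insert l {1..<l}" using l_ge_3 by auto
  then have "\<epsilon> l = 1" using v(5) \<epsilon> by simp
  then have "v (e i) = id (e i)" if "i \<in> {1..l}" for i
    using v(4)[OF that] \<pi>[OF that] \<epsilon>[of i] that by (cases "i = l") auto
  then show ?thesis by (intro frame_linear_eqI v(1)) (auto simp: linear_id)
qed

section \<open>Length and inversions\<close>

definition inversions :: "('a \<Rightarrow> 'a) \<Rightarrow> 'a set" where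
  "inversions w = {\<beta> \<in> \<Phi>. ht \<beta> > 0 \<and> ht (w \<beta>) < 0}"

lemma finite_inversions: "finite (inversions w)"
  using finite_roots by (simp add: inversions_def)

lemma simple_reflection: "i \<in> {1..l} \<Longrightarrow> s i x = x - (x \<bullet> \<alpha> i) *\<^sub>R \<alpha> i"
  using root_norm[OF simple_root] by (simp add: reflection_def)

lemma simple_reflection_self: "i \<in> {1..l} \<Longrightarrow> s i (\<alpha> i) = - \<alpha> i"
  using root_norm[OF simple_root] by (simp add: simple_reflection scaleR_2)

lemma s_involution: "s i (s i x) = x"
  using fun_cong[OF reflection_involution, of "\<alpha> i" x] by simp

lemma even_signed_perm_s: "i \<in> {1..l} \<Longrightarrow> s i \<in> even_signed_perms"
  by (intro even_signed_perm_reflection simple_root)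

text \<open>Two different roots have inner product at most one, because both have squared norm two. So the
  reflection lowers the height of \<open>\<beta>\<close> by at most one. It stays nonnegative, and the height of a
  root is never zero.\<close>
lemma simple_reflection_positive:
  assumes \<beta>: "\<beta> \<in> \<Phi>" "ht \<beta> > 0" and i: "i \<in> {1..l}" and ne: "\<beta> \<noteq> \<alpha> i"
  shows "ht (s i \<beta>) > 0"
proof -
  have "0 < (\<beta> - \<alpha> i) \<bullet> (\<beta> - \<alpha> i)" using ne by simp
  then have "\<beta> \<bullet> \<alpha> i < 2"
    using root_norm[OF \<beta>(1)] root_norm[OF simple_root[OF i]]
    by (simp add: inner_diff_left inner_diff_right inner_commute)
  then have "ht (s i \<beta>) > ht \<beta> - 2" by (simp add: simple_reflection[OF i] ht_simple[OF i])
  moreover have root: "s i \<beta> \<in> \<Phi>" by (rule even_signed_perm_root[OF even_signed_perm_s[OF i] \<beta>(1)])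
  moreover obtain x where "ht \<beta> = of_int x" using ht_root_int[OF \<beta>(1)] by (rule Ints_cases)
  moreover obtain y where "ht (s i \<beta>) = of_int y" using ht_root_int[OF root] by (rule Ints_cases)
  ultimately show ?thesis using \<beta>(2) ht_root_nz[OF root] by simp
qed

text \<open>The reflection \<open>s i\<close> permutes the positive roots other than \<open>\<alpha> i\<close>.\<close>
lemma inversions_comp_s:
  assumes i: "i \<in> {1..l}"
  shows "inversions (w \<circ> s i) - {\<alpha> i} = s i ` (inversions w - {\<alpha> i})"
proof -
  have *: "s i \<beta> \<in> \<Phi> \<and> ht (s i \<beta>) > 0 \<and> s i \<beta> \<noteq> \<alpha> i" if "\<beta> \<in> \<Phi>" "ht \<beta> > 0" "\<beta> \<noteq> \<alpha> i" for \<beta>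
  proof (intro conjI simple_reflection_positive even_signed_perm_root[OF even_signed_perm_s[OF i]] i that)
    have "ht (s i (s i \<beta>)) > 0" using that by (simp add: s_involution)
    then show "s i \<beta> \<noteq> \<alpha> i" using simple_reflection_self[OF i] ht_simple[OF i] by auto
  qed
  show ?thesis
  proof (intro equalityI subsetI)
    fix \<beta> assume "\<beta> \<in> inversions (w \<circ> s i) - {\<alpha> i}"
    then have "s i \<beta> \<in> inversions w - {\<alpha> i}" using *[of \<beta>] by (simp add: inversions_def)
    then show "\<beta> \<in> s i ` (inversions w - {\<alpha> i})" by (metis image_eqI s_involution)
  next
    fix \<beta> assume "\<beta> \<in> s i ` (inversions w - {\<alpha> i})"
    then show "\<beta> \<in> inversions (w \<circ> s i) - {\<alpha> i}" using * by (auto simp: inversions_def s_involution)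
  qed
qed

text \<open>The root \<open>\<alpha> i\<close> is an inversion of exactly one of \<open>w\<close> and \<open>w \<circ> s i\<close>, since \<open>s i\<close> negates it; the
  other inversions correspond bijectively.\<close>
lemma card_inversions_comp_s:
  assumes i: "i \<in> {1..l}" and w: "w \<in> even_signed_perms"
  shows "ht (w (\<alpha> i)) > 0 \<Longrightarrow> card (inversions (w \<circ> s i)) = Suc (card (inversions w))"
    and "ht (w (\<alpha> i)) < 0 \<Longrightarrow> card (inversions w) = Suc (card (inversions (w \<circ> s i)))"
proof -
  have eq: "card (inversions (w \<circ> s i) - {\<alpha> i}) = card (inversions w - {\<alpha> i})"
    unfolding inversions_comp_s[OF i]
    by (rule card_image) (metis inj_onI s_involution)
  have mem: "\<alpha> i \<in> inversions w \<longleftrightarrow> ht (w (\<alpha> i)) < 0"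
    using simple_root[OF i] ht_simple[OF i] by (auto simp: inversions_def)
  have mem': "\<alpha> i \<in> inversions (w \<circ> s i) \<longleftrightarrow> ht (w (\<alpha> i)) > 0"
    using simple_root[OF i] ht_simple[OF i]
    by (auto simp: inversions_def simple_reflection_self[OF i] linear_neg[OF even_signed_perm_linear[OF w]])
  show "card (inversions (w \<circ> s i)) = Suc (card (inversions w))" if "ht (w (\<alpha> i)) > 0"
    using eq mem mem' that card_Suc_Diff1[OF finite_inversions, of "\<alpha> i" "w \<circ> s i"] by simp
  show "card (inversions w) = Suc (card (inversions (w \<circ> s i)))" if "ht (w (\<alpha> i)) < 0"
    using eq mem mem' that card_Suc_Diff1[OF finite_inversions, of "\<alpha> i" w] by simp
qed

abbreviation word :: "nat list \<Rightarrow> 'a \<Rightarrow> 'a" where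
  "word is \<equiv> foldr (\<circ>) (map s is) id"

lemma word_snoc: "word (is @ [i]) = word is \<circ> s i"
  by (simp only: map_append list.map foldr_comp_append foldr_comp_Cons foldr.simps(1) id_apply comp_id)

lemma word_even_signed_perm: "set is \<subseteq> {1..l} \<Longrightarrow> word is \<in> even_signed_perms"
proof (induction "is")
  case Nil
  then show ?case using even_signed_perm_id by (simp add: id_def)
next
  case (Cons i "is")
  then have "s i \<circ> word is \<in> even_signed_perms" by (intro even_signed_perm_comp even_signed_perm_s Cons.IH) auto
  then show ?case by (simp only: list.map foldr_comp_Cons)
qed

lemma even_signed_perm_sign:
  assumes "w \<in> even_signed_perms" "i \<in> {1..l}"
  shows "ht (w (\<alpha> i)) > 0 \<or> ht (w (\<alpha> i)) < 0"
  using ht_root_nz[OF even_signed_perm_root[OF assms(1) simple_root[OF assms(2)]]] by linarith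

lemma card_inversions_word_le: "set is \<subseteq> {1..l} \<Longrightarrow> card (inversions (word is)) \<le> length is"
proof (induction "is" rule: rev_induct)
  case Nil
  have "inversions id = {}" by (auto simp: inversions_def)
  then show ?case by (simp add: id_def)
next
  case (snoc i "is")
  have w: "word is \<in> even_signed_perms" and i: "i \<in> {1..l}" using snoc.prems word_even_signed_perm by auto
  have "card (inversions (word is \<circ> s i)) \<le> Suc (card (inversions (word is)))"
    using even_signed_perm_sign[OF w i] card_inversions_comp_s[OF i w] by linarith
  moreover have "card (inversions (word is)) \<le> length is" using snoc.prems by (intro snoc.IH) auto
  moreover have "length (is @ [i]) = Suc (length is)" by simp
  ultimately show ?case unfolding word_snoc by linarith
qed

text \<open>As long as \<open>w\<close> makes some simple root negative, composing with its reflection removes one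
  inversion; the process can only stop at the identity.\<close>
lemma even_signed_perm_reduced_word:
  assumes "w \<in> even_signed_perms"
  shows "\<exists>is. length is = card (inversions w) \<and> set is \<subseteq> {1..l} \<and> w = word is"
  using assms
proof (induction "card (inversions w)" arbitrary: w rule: less_induct)
  case less
  show ?case
  proof (cases "\<forall>i\<in>{1..l}. ht (w (\<alpha> i)) > 0")
    case True
    then have "w = id" using less.prems by (intro even_signed_perm_positive_id) auto
    moreover have "inversions id = {}" by (auto simp: inversions_def)
    ultimately show ?thesis by (intro exI[of _ "[]"]) simp
  next
    case False
    then obtain i where i: "i \<in> {1..l}" "ht (w (\<alpha> i)) < 0" using even_signed_perm_sign[OF less.prems] by blast
    have card: "card (inversions w) = Suc (card (inversions (w \<circ> s i)))"
      using card_inversions_comp_s(2)[OF i(1) less.prems i(2)] .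
    then obtain "is" where "is": "length is = card (inversions (w \<circ> s i))" "set is \<subseteq> {1..l}"
      "w \<circ> s i = word is"
      using less.hyps[of "w \<circ> s i"] even_signed_perm_comp[OF less.prems even_signed_perm_s[OF i(1)]] by auto
    have "w = (w \<circ> s i) \<circ> s i" by (simp add: fun_eq_iff s_involution)
    also have "\<dots> = word (is @ [i])"
      by (simp only: word_snoc "is"(3))
    finally show ?thesis using "is" i card by (intro exI[of _ "is @ [i]"]) simp
  qed
qed

lemma length_eq_card_inversions:
  assumes "w \<in> even_signed_perms"
  shows "D_length l e w = card (inversions w)"
  unfolding D_length_def
proof (rule Least_equality)
  show "\<exists>is. length is = card (inversions w) \<and> set is \<subseteq> {1..l} \<and> w = word is"
    by (rule even_signed_perm_reduced_word[OF assms])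
  show "card (inversions w) \<le> n" if "\<exists>is. length is = n \<and> set is \<subseteq> {1..l} \<and> w = word is" for n
    using that card_inversions_word_le by auto
qed

lemma parabolic_eq_words: "D_parabolic l e j = {word is | is. set is \<subseteq> {1..l} - {j}}"
proof -
  have "D_parabolic l e j = {foldr (\<circ>) ws id | ws. set ws \<subseteq> s ` ({1..l} - {j})}"
    unfolding D_parabolic_def using reflection_involution by (intro generate_involutions) auto
  moreover have "{ws. set ws \<subseteq> s ` ({1..l} - {j})} = map s ` {is. set is \<subseteq> {1..l} - {j}}"
    using lists_image[of s "{1..l} - {j}"] by (simp only: lists_eq_set)
  ultimately show ?thesis by (simp only: setcompr_eq_image image_image)
qed

lemma weyl_eq_even_signed_perms: "D_weyl l e = even_signed_perms"
proof -
  have eq: "D_weyl l e = {foldr (\<circ>) ws id | ws. set ws \<subseteq> reflection ` \<Phi>}"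
    unfolding D_weyl_def using reflection_involution by (intro generate_involutions) auto
  have "foldr (\<circ>) ws id \<in> even_signed_perms" if "set ws \<subseteq> reflection ` \<Phi>" for ws
    using that
  proof (induction ws)
    case Nil
    then show ?case using even_signed_perm_id by (simp add: id_def)
  next
    case (Cons x ws)
    then obtain \<beta> where "\<beta> \<in> \<Phi>" "x = reflection \<beta>" by auto
    then have "x \<in> even_signed_perms" by (simp add: even_signed_perm_reflection)
    then have "x \<circ> foldr (\<circ>) ws id \<in> even_signed_perms"
      using Cons.prems by (intro even_signed_perm_comp Cons.IH) auto
    then show ?case by (simp only: foldr_comp_Cons)
  qed
  moreover have "\<exists>ws. w = foldr (\<circ>) ws id \<and> set ws \<subseteq> reflection ` \<Phi>" if w: "w \<in> even_signed_perms" for w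
  proof -
    obtain "is" where "set is \<subseteq> {1..l}" "w = word is" using even_signed_perm_reduced_word[OF w] by blast
    then have "w = foldr (\<circ>) (map s is) id \<and> set (map s is) \<subseteq> reflection ` \<Phi>"
      using simple_root by (simp only: simp_thms set_map) blast
    then show ?thesis by blast
  qed
  ultimately show ?thesis unfolding eq by blast
qed

text \<open>If an element \<open>w\<close> of maximal length kept some \<open>\<alpha> i\<close> with \<open>i \<in> J\<close> positive, then \<open>w \<circ> s i\<close> would be
  longer. A maximum exists because there are no more inversions than roots.\<close>
lemma longest_unique:
  assumes X: "X \<subseteq> even_signed_perms" "id \<in> X" "\<And>w i. w \<in> X \<Longrightarrow> i \<in> J \<Longrightarrow> w \<circ> s i \<in> X"
    and J: "J \<subseteq> {1..l}"
    and unique: "\<And>w. w \<in> X \<Longrightarrow> (\<And>i. i \<in> J \<Longrightarrow> ht (w (\<alpha> i)) < 0) \<Longrightarrow> w = u"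
  shows "D_longest l e X = u"
proof -
  have len: "D_length l e w = card (inversions w)" if "w \<in> X" for w
    using that X(1) by (intro length_eq_card_inversions) auto
  have max_imp: "w = u" if "is_arg_max (D_length l e) (\<lambda>w. w \<in> X) w" for w
  proof (rule unique)
    show w: "w \<in> X" using that by (simp add: is_arg_max_def)
    fix i assume i: "i \<in> J"
    have "w \<circ> s i \<in> X" using X(3)[OF w i] .
    then have "\<not> card (inversions (w \<circ> s i)) > card (inversions w)"
      using that len[OF w] len[of "w \<circ> s i"] by (auto simp: is_arg_max_def)
    moreover have w': "w \<in> even_signed_perms" and i': "i \<in> {1..l}" using w X(1) i J by auto
    ultimately show "ht (w (\<alpha> i)) < 0"
      using card_inversions_comp_s(1)[OF i' w'] even_signed_perm_sign[OF w' i'] by linarith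
  qed
  have "card (inversions w) \<le> card \<Phi>" for w
    by (rule card_mono[OF finite_roots]) (auto simp: inversions_def)
  then have "\<exists>w. w \<in> X \<and> (\<forall>v. v \<in> X \<longrightarrow> D_length l e v \<le> D_length l e w)"
    using len X(2) by (intro ex_has_greatest_nat[of "\<lambda>w. w \<in> X" id _ "Suc (card \<Phi>)"]) (auto simp: less_Suc_eq_le)
  then obtain w where w: "is_arg_max (D_length l e) (\<lambda>w. w \<in> X) w"
    by (auto simp: is_arg_max_linorder)
  moreover have "w = u" using w by (rule max_imp)
  ultimately show ?thesis
    unfolding D_longest_def by (intro the_equality max_imp) auto
qed

section \<open>The two longest elements\<close>

text \<open>The map on the right, \<open>u\<close> below, negates heights because \<open>e l\<close> has height zero. So if \<open>w\<close> makes all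
  simple roots negative, then \<open>u \<circ> w\<close> keeps them positive and is the identity. For odd \<open>l\<close> the map
  \<open>u\<close> changes an even number of signs.\<close>
lemma longest_weyl:
  assumes "odd l"
  shows "D_longest l e (D_weyl l e) = (\<lambda>x. (2 * (x \<bullet> e l)) *\<^sub>R e l - x)"
proof -
  define u where "u x = (2 * (x \<bullet> e l)) *\<^sub>R e l - x" for x
  have inv: "u (u x) = x" for x
    using l_ge_3 by (simp add: u_def inner_diff_left inner_frame)
  have ht: "ht (u x) = - ht x" for x
    using l_ge_3 by (simp add: u_def ht_frame)
  have "{1..l} = insert l {1..<l}" using l_ge_3 by auto
  then have "(\<Prod>i = 1..l. if i = l then 1 else - 1) = (1::real)" using assms by simp
  then have u: "u \<in> even_signed_perms"
    using l_ge_3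
    by (intro even_signed_permsI[of _ id "\<lambda>i. if i = l then 1 else - 1"] linearI)
       (auto simp: u_def inner_add_left inner_frame permutes_id algebra_simps scaleR_2)
  have "D_longest l e even_signed_perms = u"
  proof (rule longest_unique[where J = "{1..l}"])
    fix w assume w: "w \<in> even_signed_perms" "\<And>i. i \<in> {1..l} \<Longrightarrow> ht (w (\<alpha> i)) < 0"
    have id: "u \<circ> w = id" using w u by (intro even_signed_perm_positive_id even_signed_perm_comp) (auto simp: ht)
    have "u (w x) = x" for x using fun_cong[OF id, of x] by simp
    then have "w x = u x" for x using inv[of "w x"] by simp
    then show "w = u" by (rule ext)
  qed (use even_signed_perm_id even_signed_perm_comp[OF _ even_signed_perm_s] in blast)+
  then show ?thesis by (simp add: weyl_eq_even_signed_perms u_def[abs_def])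
qed

text \<open>Both choices of \<open>j\<close> are treated at once by a sign \<open>\<eta>\<close>: the value \<open>1\<close> stands for the node \<open>l\<close> and
  \<open>-1\<close> for the node \<open>l - 1\<close>.\<close>
definition spin_node :: "real \<Rightarrow> nat" where
  "spin_node \<eta> = (if \<eta> = 1 then l else l - 1)"

definition twist :: "real \<Rightarrow> nat \<Rightarrow> 'a" where
  "twist \<eta> i = (if i = l then \<eta> *\<^sub>R e l else e i)"

lemma orthonormal_twist:
  assumes "\<eta> \<in> {1, -1}"
  shows "orthonormal_frame l (twist \<eta>)"
proof
  show "twist \<eta> i \<bullet> twist \<eta> k = (if i = k then 1 else 0)" if "i \<in> {1..l}" "k \<in> {1..l}" for i k
    using assms that by (auto simp: twist_def inner_frame)
  have eq: "(\<Sum>i = 1..l. (x \<bullet> twist \<eta> i) *\<^sub>R twist \<eta> i) = (\<Sum>i = 1..l. (x \<bullet> e i) *\<^sub>R e i)" for x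
    using assms by (intro sum.cong) (auto simp: twist_def)
  show "(\<Sum>i = 1..l. (x \<bullet> twist \<eta> i) *\<^sub>R twist \<eta> i) = x" for x
    unfolding eq by (rule frame_expansion)
qed

lemma ht_twist: "i \<in> {1..l} \<Longrightarrow> ht (twist \<eta> i) = real l - real i"
  by (auto simp: twist_def ht_frame)

text \<open>For \<open>\<eta> = -1\<close> the last difference is \<open>e (l - 1) + e l = \<alpha> l\<close>, so that in the twisted frame the
  remaining simple roots form a chain of type \<open>A\<close> for either sign.\<close>
lemma parabolic_simple_roots:
  assumes "\<eta> \<in> {1, -1}"
  shows "\<alpha> ` ({1..l} - {spin_node \<eta>}) = (\<lambda>k. twist \<eta> k - twist \<eta> (Suc k)) ` {1..<l}"
proof (cases "\<eta> = 1")
  case True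
  then have "{1..l} - {spin_node \<eta>} = {1..<l}" by (auto simp: spin_node_def)
  moreover have "\<alpha> k = twist \<eta> k - twist \<eta> (Suc k)" if "k \<in> {1..<l}" for k
    using True that by (auto simp: twist_def D_simple_def)
  ultimately show ?thesis by simp
next
  case False
  then have \<eta>: "\<eta> = -1" using assms by simp
  have "{1..l} - {spin_node \<eta>} = insert l {1..<l - 1}" "{1..<l} = insert (l - 1) {1..<l - 1}"
    using l_ge_3 \<eta> by (auto simp: spin_node_def)
  moreover have "\<alpha> k = twist \<eta> k - twist \<eta> (Suc k)" if "k \<in> {1..<l - 1}" for k
    using that by (auto simp: twist_def D_simple_def)
  moreover have "\<alpha> l = twist \<eta> (l - 1) - twist \<eta> (Suc (l - 1))"
    using l_ge_3 \<eta> by (auto simp: twist_def D_simple_def)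
  ultimately show ?thesis by (simp cong: image_cong_simp)
qed

lemma parabolic_permutes_twist:
  assumes \<eta>: "\<eta> \<in> {1, -1}" and "set is \<subseteq> {1..l} - {spin_node \<eta>}"
  shows "\<exists>\<pi>. \<pi> permutes {1..l} \<and> (\<forall>i\<in>{1..l}. word is (twist \<eta> i) = twist \<eta> (\<pi> i))"
  using assms(2)
proof (induction "is")
  case Nil
  then show ?case by (intro exI[of _ id]) (simp add: permutes_id[unfolded id_def])
next
  case (Cons i "is")
  interpret f: orthonormal_frame l "twist \<eta>" by (rule orthonormal_twist[OF \<eta>])
  have "set is \<subseteq> {1..l} - {spin_node \<eta>}" using Cons.prems by simp
  then obtain \<pi> where \<pi>: "\<pi> permutes {1..l}"
    "\<And>i. i \<in> {1..l} \<Longrightarrow> word is (twist \<eta> i) = twist \<eta> (\<pi> i)"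
    using Cons.IH by blast
  have "\<alpha> i \<in> \<alpha> ` ({1..l} - {spin_node \<eta>})" using Cons.prems by auto
  then obtain k where k: "k \<in> {1..<l}" "\<alpha> i = twist \<eta> k - twist \<eta> (Suc k)"
    unfolding parabolic_simple_roots[OF \<eta>] by auto
  have s: "s i (twist \<eta> n) = twist \<eta> (Transposition.transpose k (Suc k) n)" if "n \<in> {1..l}" for n
    using f.reflection_frame_pair[of k "Suc k" 1 "-1" n] k that by (simp split: if_splits)
  have "Transposition.transpose k (Suc k) \<circ> \<pi> permutes {1..l}"
    using k by (intro permutes_compose \<pi>(1) permutes_swap_id) auto
  moreover have "word (i # is) (twist \<eta> n) = twist \<eta> ((Transposition.transpose k (Suc k) \<circ> \<pi>) n)"
    if "n \<in> {1..l}" for n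
    using \<pi>(2)[OF that] s[of "\<pi> n"] permutes_in_image[OF \<pi>(1), of n] that by simp
  ultimately show ?case by blast
qed

text \<open>An element of the parabolic subgroup permutes the twisted frame by some \<open>\<pi>\<close>. As \<open>twist \<eta> k\<close> has
  height \<open>l - k\<close>, it makes all the simple roots of the subgroup negative only if \<open>\<pi>\<close> is decreasing,
  that is, the order reversal.\<close>
lemma longest_parabolic:
  assumes \<eta>: "\<eta> \<in> {1, -1}"
  shows "D_longest l e (D_parabolic l e (spin_node \<eta>)) =
    (\<lambda>x. \<Sum>i = 1..l. (x \<bullet> twist \<eta> i) *\<^sub>R twist \<eta> (l + 1 - i))" (is "_ = ?u")
proof (rule longest_unique[where J = "{1..l} - {spin_node \<eta>}"])
  interpret f: orthonormal_frame l "twist \<eta>" by (rule orthonormal_twist[OF \<eta>])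
  show "D_parabolic l e (spin_node \<eta>) \<subseteq> even_signed_perms"
    unfolding parabolic_eq_words using word_even_signed_perm by blast
  show "id \<in> D_parabolic l e (spin_node \<eta>)"
    unfolding parabolic_eq_words by (rule CollectI, rule exI[of _ "[]"]) (simp add: id_def)
  show "w \<circ> s i \<in> D_parabolic l e (spin_node \<eta>)"
    if w: "w \<in> D_parabolic l e (spin_node \<eta>)" and i: "i \<in> {1..l} - {spin_node \<eta>}" for w i
  proof -
    obtain "is" where "is": "w = word is" "set is \<subseteq> {1..l} - {spin_node \<eta>}"
      using w unfolding parabolic_eq_words by blast
    have "w \<circ> s i = word (is @ [i])"
      by (simp only: word_snoc "is"(1))
    then show ?thesis
      unfolding parabolic_eq_words using "is" i by (intro CollectI exI[of _ "is @ [i]"]) auto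
  qed
  fix w assume w: "w \<in> D_parabolic l e (spin_node \<eta>)"
    and neg: "\<And>i. i \<in> {1..l} - {spin_node \<eta>} \<Longrightarrow> ht (w (\<alpha> i)) < 0"
  obtain "is" where "is": "w = word is" "set is \<subseteq> {1..l} - {spin_node \<eta>}"
    using w unfolding parabolic_eq_words by blast
  then obtain \<pi> where \<pi>: "\<pi> permutes {1..l}" "\<And>i. i \<in> {1..l} \<Longrightarrow> w (twist \<eta> i) = twist \<eta> (\<pi> i)"
    using parabolic_permutes_twist[OF \<eta>] by blast
  have range: "\<pi> k \<in> {1..l}" if "k \<in> {1..l}" for k using permutes_in_image[OF \<pi>(1)] that by blast
  have "w \<in> even_signed_perms" unfolding "is"(1) using "is"(2) by (intro word_even_signed_perm) auto
  then have lin: "linear w" by (rule even_signed_perm_linear)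
  have decr: "\<pi> (Suc k) < \<pi> k" if "1 \<le> k" "k < l" for k
  proof -
    have root: "twist \<eta> k - twist \<eta> (Suc k) \<in> \<alpha> ` ({1..l} - {spin_node \<eta>})"
      unfolding parabolic_simple_roots[OF \<eta>] using that by auto
    obtain i where "i \<in> {1..l} - {spin_node \<eta>}" "\<alpha> i = twist \<eta> k - twist \<eta> (Suc k)"
      by (rule imageE[OF root]) metis
    then have "ht (w (twist \<eta> k - twist \<eta> (Suc k))) < 0" using neg[of i] by simp
    then show ?thesis
      using \<pi>(2)[of k] \<pi>(2)[of "Suc k"] range[of k] range[of "Suc k"] that
      by (simp add: linear_diff[OF lin] ht_twist)
  qed
  have rev: "l + 1 - \<pi> i = i" if "i \<in> {1..l}" for i
  proof (rule strictly_increasing_self_map_id[of l "\<lambda>i. l + 1 - \<pi> i"])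
    show "l + 1 - \<pi> k \<in> {1..l}" if "k \<in> {1..l}" for k using range[OF that] by auto
    show "l + 1 - \<pi> k < l + 1 - \<pi> (Suc k)" if "1 \<le> k" "k < l" for k
      using decr[OF that] range[of k] that by auto
  qed (rule that)
  show "w = ?u"
  proof (rule f.frame_linear_eqI[OF lin])
    show "linear ?u"
      by (rule linearI) (simp_all add: inner_add_left scaleR_add_left sum.distrib scaleR_sum_right)
    fix i assume i: "i \<in> {1..l}"
    have "\<pi> i = l + 1 - i" using rev[OF i] range[OF i] i by auto
    moreover have "?u (twist \<eta> i) = twist \<eta> (l + 1 - i)"
      using i by (simp add: f.inner_frame if_distrib[of "\<lambda>c. c *\<^sub>R _"] sum.delta cong: if_cong)
    ultimately show "w (twist \<eta> i) = ?u (twist \<eta> i)" using \<pi>(2)[OF i] by simp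
  qed
qed auto

section \<open>The element omega and its projection\<close>

abbreviation \<omega> :: "real \<Rightarrow> 'a \<Rightarrow> 'a" where "\<omega> \<eta> \<equiv> D_omega l e (spin_node \<eta>)"

lemma omega_twist:
  assumes \<eta>: "\<eta> \<in> {1, -1}" and "odd l" and k: "k \<in> {1..l}"
  shows "\<omega> \<eta> x \<bullet> twist \<eta> k = (if k = 1 then x \<bullet> twist \<eta> l else - (x \<bullet> twist \<eta> (l + 1 - k)))"
proof -
  interpret f: orthonormal_frame l "twist \<eta>" by (rule orthonormal_twist[OF \<eta>])
  let ?y = "(2 * (x \<bullet> e l)) *\<^sub>R e l - x"
  have "\<omega> \<eta> x \<bullet> twist \<eta> k = (\<Sum>i = 1..l. (?y \<bullet> twist \<eta> i) * (twist \<eta> (l + 1 - i) \<bullet> twist \<eta> k))"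
    unfolding D_omega_def longest_parabolic[OF \<eta>] longest_weyl[OF \<open>odd l\<close>]
    by (simp add: inner_sum_left)
  also have "\<dots> = (\<Sum>i = 1..l. if i = l + 1 - k then ?y \<bullet> twist \<eta> i else 0)"
  proof (intro sum.cong refl)
    fix i assume "i \<in> {1..l}"
    then have "twist \<eta> (l + 1 - i) \<bullet> twist \<eta> k = (if l + 1 - i = k then 1 else 0)"
      using k by (intro f.inner_frame) auto
    moreover have "l + 1 - i = k \<longleftrightarrow> i = l + 1 - k" using k \<open>i \<in> {1..l}\<close> by auto
    ultimately show "(?y \<bullet> twist \<eta> i) * (twist \<eta> (l + 1 - i) \<bullet> twist \<eta> k) =
        (if i = l + 1 - k then ?y \<bullet> twist \<eta> i else 0)" by simp
  qed
  also have "\<dots> = ?y \<bullet> twist \<eta> (l + 1 - k)"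
  proof -
    have "l + 1 - k \<in> {1..l}" using k by auto
    then show ?thesis by (subst sum.delta) auto
  qed
  also have "\<dots> = (if k = 1 then x \<bullet> twist \<eta> l else - (x \<bullet> twist \<eta> (l + 1 - k)))"
  proof (cases "k = 1")
    case True
    then show ?thesis using l_ge_3 by (simp add: twist_def inner_diff_left inner_frame)
  next
    case False
    then have "l + 1 - k \<in> {1..<l}" using k by auto
    then have "e l \<bullet> e (l + 1 - k) = 0" "twist \<eta> (l + 1 - k) = e (l + 1 - k)"
      using inner_frame[of l "l + 1 - k"] by (auto simp: twist_def)
    then show ?thesis using False by (simp add: inner_diff_left)
  qed
  finally show ?thesis .
qed

lemma linear_omega:
  assumes "\<eta> \<in> {1, -1}" "odd l"
  shows "linear (\<omega> \<eta>)"
proof -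
  interpret f: orthonormal_frame l "twist \<eta>" by (rule orthonormal_twist[OF assms(1)])
  show ?thesis
    by (rule linearI; rule f.frame_eqI) (simp_all add: omega_twist[OF assms] inner_add_left)
qed

lemma omega_coord:
  assumes \<eta>: "\<eta> \<in> {1, -1}" and "odd l"
  shows "\<omega> \<eta> x \<bullet> e 1 = \<eta> * (x \<bullet> e l)" "\<omega> \<eta> x \<bullet> e l = - \<eta> * (x \<bullet> e 1)"
    "k \<in> {2..l - 1} \<Longrightarrow> \<omega> \<eta> x \<bullet> e k = - (x \<bullet> e (l + 1 - k))"
proof -
  have tl: "twist \<eta> l = \<eta> *\<^sub>R e l" by (simp add: twist_def)
  have t: "twist \<eta> i = e i" if "i < l" for i using that by (simp add: twist_def)
  show "\<omega> \<eta> x \<bullet> e 1 = \<eta> * (x \<bullet> e l)"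
    using omega_twist[OF assms, of 1 x] l_ge_3 by (simp add: tl t)
  show "\<omega> \<eta> x \<bullet> e l = - \<eta> * (x \<bullet> e 1)"
    using omega_twist[OF assms, of l x] l_ge_3 \<eta> by (auto simp: tl t)
  show "\<omega> \<eta> x \<bullet> e k = - (x \<bullet> e (l + 1 - k))" if "k \<in> {2..l - 1}"
    using omega_twist[OF assms, of k x] l_ge_3 that t[of k] t[of "l + 1 - k"] by auto
qed

text \<open>A step exchanges the coordinates at \<open>i\<close> and \<open>l + 1 - i\<close> up to sign; the signs multiply to \<open>1\<close> after
  two steps in the middle and to \<open>-1\<close> after two steps at the ends.\<close>
lemma omega_power_four:
  assumes "\<eta> \<in> {1, -1}" "odd l"
  shows "\<omega> \<eta> (\<omega> \<eta> (\<omega> \<eta> (\<omega> \<eta> x))) = x"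
proof (rule frame_eqI)
  fix i assume "i \<in> {1..l}"
  then consider "i = 1" | "i = l" | "i \<in> {2..l - 1}" "l + 1 - i \<in> {2..l - 1}" "l + 1 - (l + 1 - i) = i"
    by force
  then show "\<omega> \<eta> (\<omega> \<eta> (\<omega> \<eta> (\<omega> \<eta> x))) \<bullet> e i = x \<bullet> e i"
    by cases (use assms(1) in \<open>auto simp only: omega_coord[OF assms]\<close>)
qed

end

lemma BijGroup_UNIV_pow:
  assumes "bij f"
  shows "f [^]\<^bsub>BijGroup UNIV\<^esub> n = f ^^ (n::nat)"
proof (induction n)
  case 0
  then show ?case by (simp add: BijGroup_UNIV_simps)
next
  case (Suc n)
  have "f ^^ n \<otimes>\<^bsub>BijGroup UNIV\<^esub> f = f ^^ n \<circ> f"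
    using assms by (intro BijGroup_UNIV_simps bij_fn)
  then show ?case using Suc by (simp only: nat_pow_Suc funpow_Suc_right)
qed

context D_frame
begin

text \<open>The order divides four, and it does not divide two because \<open>\<omega>\<close> squared negates \<open>e 1\<close>.\<close>
lemma omega_order:
  assumes "\<eta> \<in> {1, -1}" "odd l"
  shows "group.ord (BijGroup UNIV) (\<omega> \<eta>) = 4"
proof -
  interpret group "BijGroup (UNIV :: 'a set)" by (rule group_BijGroup)
  let ?f = "\<omega> \<eta>"
  have bij: "bij ?f"
    by (rule o_bij[of "\<lambda>x. ?f (?f (?f x))"]) (simp_all add: fun_eq_iff omega_power_four[OF assms])
  then have carrier: "?f \<in> carrier (BijGroup UNIV)" by (simp add: BijGroup_UNIV_simps)
  have pow: "(?f ^^ n = id) = (ord ?f dvd n)" for n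
    using pow_eq_id[OF carrier, of n] by (simp add: BijGroup_UNIV_pow[OF bij] BijGroup_UNIV_simps)
  have "?f ^^ 4 = id"
    by (simp add: fun_eq_iff numeral_eq_Suc omega_power_four[OF assms])
  then have "ord ?f dvd 4" by (simp add: pow)
  moreover have "(?f ^^ 2) (e 1) \<bullet> e 1 = -1"
    using assms(1) l_ge_3 by (auto simp: numeral_2_eq_2 omega_coord[OF assms, simplified] inner_frame)
  then have "?f ^^ 2 \<noteq> id" using l_ge_3 by (auto simp: inner_frame)
  then have "\<not> ord ?f dvd 2" by (simp add: pow)
  moreover have "d = 4" if "d dvd 4" "\<not> d dvd 2" for d :: nat
  proof -
    have "d \<le> 4" using that(1) by (intro dvd_imp_le) auto
    then have "d \<in> {0, 1, 2, 3, 4}" by auto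
    then show ?thesis using that by auto
  qed
  ultimately show ?thesis by blast
qed

text \<open>The average has coordinate zero at \<open>1\<close> and \<open>l\<close>, and half the difference of the coordinates of \<open>x\<close>
  at \<open>i\<close> and \<open>l + 1 - i\<close> at every other place \<open>i\<close>.\<close>
lemma omega_avg_eq_0_iff:
  assumes "\<eta> \<in> {1, -1}" "odd l"
  shows "omega_avg (\<omega> \<eta>) x = 0 \<longleftrightarrow> (\<forall>i\<in>{2..l - 1}. x \<bullet> e i = x \<bullet> e (l + 1 - i))"
proof -
  let ?f = "\<omega> \<eta>"
  have avg: "omega_avg ?f x = (1 / 4) *\<^sub>R (?f x + ?f (?f x) + ?f (?f (?f x)) + x)"
    unfolding omega_avg_def omega_order[OF assms]
    by (simp add: numeral_eq_Suc omega_power_four[OF assms])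
  have mid: "omega_avg ?f x \<bullet> e i = (x \<bullet> e i - x \<bullet> e (l + 1 - i)) / 2" if i: "i \<in> {2..l - 1}" for i
  proof -
    have i': "l + 1 - i \<in> {2..l - 1}" "l + 1 - (l + 1 - i) = i" using i by auto
    show ?thesis
      by (simp only: avg inner_scaleR_left inner_add_left omega_coord(3)[OF assms i]
          omega_coord(3)[OF assms i'(1)] i'(2)) simp
  qed
  have ends: "omega_avg ?f x \<bullet> e i = 0" if "i \<in> {1, l}" for i
  proof -
    have "omega_avg ?f x \<bullet> e 1 = 0" "omega_avg ?f x \<bullet> e l = 0"
      using assms(1)
      by (simp_all only: avg inner_scaleR_left inner_add_left omega_coord(1,2)[OF assms]) auto
    then show ?thesis using that by auto
  qed
  show ?thesis
  proof
    assume "omega_avg ?f x = 0"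
    then show "\<forall>i\<in>{2..l - 1}. x \<bullet> e i = x \<bullet> e (l + 1 - i)" using mid by simp
  next
    assume *: "\<forall>i\<in>{2..l - 1}. x \<bullet> e i = x \<bullet> e (l + 1 - i)"
    show "omega_avg ?f x = 0"
    proof (rule frame_eqI)
      fix i assume "i \<in> {1..l}"
      then have "i \<in> {1, l} \<or> i \<in> {2..l - 1}" by auto
      then show "omega_avg ?f x \<bullet> e i = 0 \<bullet> e i" using * mid ends by auto
    qed
  qed
qed

section \<open>Positive roots with vanishing projection\<close>

lemma pos_zero_iff:
  assumes "\<eta> \<in> {1, -1}" "odd l"
  shows "\<beta> \<in> D_pos_zero l e (spin_node \<eta>) \<longleftrightarrow>
    \<beta> \<in> \<Phi> \<and> ht \<beta> > 0 \<and> (\<forall>i\<in>{2..l - 1}. \<beta> \<bullet> e i = \<beta> \<bullet> e (l + 1 - i))"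
  by (simp add: D_pos_zero_def pos_roots_eq omega_avg_eq_0_iff[OF assms])

text \<open>If a root \<open>e p \<plusminus> e q\<close> has a nonzero coordinate at a middle place, then the mirror place \<open>l + 1 - p\<close>
  or \<open>l + 1 - q\<close> carries the same coordinate. So it is that place itself, which is then \<open>m\<close>, or it
  is the other place of the root and the sign is \<open>+\<close>.\<close>
lemma pos_zero_eq:
  fixes m :: nat
  assumes \<eta>: "\<eta> \<in> {1, -1}" and l: "l = 2 * m - 1" "m \<ge> 3"
  shows "D_pos_zero l e (spin_node \<eta>) =
    {e 1 + e m, e 1 - e m, e m + e l, e m - e l, e 1 + e l, e 1 - e l} \<union>
    {e i + e (l - i + 1) | i. i \<in> {2..m - 1}}" (is "_ = ?A \<union> ?B")
proof (intro equalityI subsetI)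
  have odd: "odd l" using l by simp
  note iff = pos_zero_iff[OF \<eta> odd]
  fix \<beta> assume "\<beta> \<in> D_pos_zero l e (spin_node \<eta>)"
  then have \<beta>: "\<beta> \<in> \<Phi>" "ht \<beta> > 0" and sym: "\<And>i. i \<in> {2..l - 1} \<Longrightarrow> \<beta> \<bullet> e i = \<beta> \<bullet> e (l + 1 - i)"
    unfolding iff by auto
  obtain b p q where b: "b \<in> {1, -1}" and pq: "p \<in> {1..l}" "q \<in> {1..l}" "p < q"
    and eq: "\<beta> = e p + b *\<^sub>R e q" using \<beta> by (rule pos_root_cases) blast
  have coord: "\<beta> \<bullet> e i = (if i = p then 1 else 0) + b * (if i = q then 1 else 0)" if "i \<in> {1..l}" for i
    using pq that by (auto simp: eq inner_add_left inner_frame)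
  have p: "p = 1 \<or> p = m \<or> (b = 1 \<and> q = l + 1 - p)"
  proof (rule ccontr)
    assume *: "\<not> ?thesis"
    then have "\<beta> \<bullet> e p = \<beta> \<bullet> e (l + 1 - p)" using pq by (intro sym) auto
    moreover have "l + 1 - p \<in> {1..l}" using pq by auto
    ultimately have "1 = (if l + 1 - p = p then 1 else 0) + b * (if l + 1 - p = q then 1 else 0)"
      using coord[of p] coord[of "l + 1 - p"] pq by simp
    then show False using * l b pq by (auto split: if_splits)
  qed
  have q: "q = l \<or> q = m \<or> (b = 1 \<and> p = l + 1 - q)"
  proof (rule ccontr)
    assume *: "\<not> ?thesis"
    then have "\<beta> \<bullet> e q = \<beta> \<bullet> e (l + 1 - q)" using pq by (intro sym) auto
    moreover have "l + 1 - q \<in> {1..l}" using pq by auto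
    ultimately have "b = (if l + 1 - q = p then 1 else 0) + b * (if l + 1 - q = q then 1 else 0)"
      using coord[of q] coord[of "l + 1 - q"] pq by simp
    then show False using * l b pq by (auto split: if_splits)
  qed
  \<comment> \<open>If only one of the alternatives for \<open>p\<close> and \<open>q\<close> is a mirror pair, then it is \<open>{1, l}\<close>.\<close>
  consider "p \<in> {1, m}" "q \<in> {m, l}" | "p \<in> {2..m - 1}" "q = l - p + 1" "b = 1"
    using p q pq l by fastforce
  then show "\<beta> \<in> ?A \<union> ?B"
  proof cases
    case 1
    then show ?thesis using b pq eq by auto
  next
    case 2
    then show ?thesis using eq by auto
  qed
next
  have odd: "odd l" using l by simp
  note iff = pos_zero_iff[OF \<eta> odd]
  have memI: "e p + b *\<^sub>R e q \<in> D_pos_zero l e (spin_node \<eta>)"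
    if "b \<in> {1, -1}" "p \<in> {1..l}" "q \<in> {1..l}" "p < q"
      "{p, q} \<subseteq> {1, m, l} \<or> (b = 1 \<and> q = l + 1 - p)" for b p q
    unfolding iff
  proof (intro conjI ballI)
    show "e p + b *\<^sub>R e q \<in> \<Phi>" using rootI[of 1 b p q] that by auto
    show "ht (e p + b *\<^sub>R e q) > 0" using that by (auto simp: ht_frame)
    fix i assume i: "i \<in> {2..l - 1}"
    then have bounds: "2 \<le> i" "i \<le> l - 1" by auto
    have i': "i \<in> {1..l}" "l + 1 - i \<in> {1..l}" using i by auto
    have coord: "(e p + b *\<^sub>R e q) \<bullet> e n = (if p = n then 1 else 0) + b * (if q = n then 1 else 0)"
      if "n \<in> {1..l}" for n
      using that \<open>p \<in> {1..l}\<close> \<open>q \<in> {1..l}\<close> by (simp add: inner_add_left inner_frame)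
    have fixed: "n = i \<longleftrightarrow> n = l + 1 - i" if "n \<in> {1, m, l}" for n
    proof -
      have "l + 1 = 2 * m" "n = 1 \<or> n = m \<or> n = l" using l that by auto
      then show ?thesis using bounds by linarith
    qed
    have swapped: "(p = i \<longleftrightarrow> q = l + 1 - i) \<and> (q = i \<longleftrightarrow> p = l + 1 - i)" if "q = l + 1 - p"
    proof -
      have "p \<le> l" using \<open>p \<in> {1..l}\<close> by simp
      then show ?thesis using that bounds by linarith
    qed
    show "(e p + b *\<^sub>R e q) \<bullet> e i = (e p + b *\<^sub>R e q) \<bullet> e (l + 1 - i)"
      unfolding coord[OF i'(1)] coord[OF i'(2)]
      using that(5)
    proof
      assume "{p, q} \<subseteq> {1, m, l}"
      then have "p \<in> {1, m, l}" "q \<in> {1, m, l}" by simp_all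
      from fixed[OF this(1)] fixed[OF this(2)]
      show "(if p = i then 1 else 0) + b * (if q = i then 1 else 0) =
          (if p = l + 1 - i then 1 else 0) + b * (if q = l + 1 - i then 1 else 0)" by (simp only:)
    next
      assume *: "b = 1 \<and> q = l + 1 - p"
      show "(if p = i then 1 else 0) + b * (if q = i then 1 else 0) =
          (if p = l + 1 - i then 1 else 0) + b * (if q = l + 1 - i then 1 else 0)"
        using swapped * by (simp only: mult_1 add.commute)
    qed
  qed
  fix \<beta> assume "\<beta> \<in> ?A \<union> ?B"
  then show "\<beta> \<in> D_pos_zero l e (spin_node \<eta>)"
  proof
    assume "\<beta> \<in> ?A"
    then show ?thesis
      using memI[of 1 1 m] memI[of "-1" 1 m] memI[of 1 m l] memI[of "-1" m l]
        memI[of 1 1 l] memI[of "-1" 1 l] l by auto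
  next
    assume "\<beta> \<in> ?B"
    then obtain i where "i \<in> {2..m - 1}" "\<beta> = e i + e (l - i + 1)" by auto
    moreover from this have "l - i + 1 = l + 1 - i" using l by auto
    ultimately show ?thesis using memI[of 1 i "l + 1 - i"] l by auto
  qed
qed

lemma sum_simple_roots:
  assumes "1 \<le> a" "a \<le> Suc b" "b < l"
  shows "(\<Sum>k = a..b. \<alpha> k) = e a - e (Suc b)"
proof -
  have "(\<Sum>k = a..b. \<alpha> k) = (\<Sum>k = a..b. (- e (Suc k)) - (- e k))"
    using assms by (intro sum.cong) (auto simp: D_simple_def)
  also have "\<dots> = e a - e (Suc b)" using assms(2) by (subst sum_Suc_diff) auto
  finally show ?thesis .
qed

text \<open>A run of simple roots telescopes to \<open>e a - e (b + 1)\<close>, and \<open>\<alpha> (l - 1) + \<alpha> l = 2 e (l - 1)\<close> absorbs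
  the vector left over by a doubled run.\<close>
lemma simple_root_expansions:
  fixes m :: nat
  assumes l: "l = 2 * m - 1" "m \<ge> 3"
  shows "(\<Sum>k = 1..m - 1. \<alpha> k) = e 1 - e m"
    and "{(\<Sum>k = m..l - 2. \<alpha> k) + \<alpha> p | p. p \<in> {l - 1, l}} = {e m - e l, e m + e l}"
    and "{(\<Sum>k = 1..l - 2. \<alpha> k) + \<alpha> p | p. p \<in> {l - 1, l}} = {e 1 - e l, e 1 + e l}"
    and "i \<in> {2..m - 1} \<Longrightarrow> (\<Sum>k = i..l - i. \<alpha> k) + (\<Sum>k = l - i + 1..l - 2. 2 *\<^sub>R \<alpha> k) + \<alpha> (l - 1) + \<alpha> l
      = e i + e (l - i + 1)"
    and "(\<Sum>k = 1..m - 1. \<alpha> k) + (\<Sum>k = m..l - 2. 2 *\<^sub>R \<alpha> k) + \<alpha> (l - 1) + \<alpha> l = e 1 + e m"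
proof -
  have fork: "\<alpha> (l - 1) = e (l - 1) - e l" "\<alpha> l = e (l - 1) + e l"
  proof -
    have "l - 1 \<noteq> l" "l - 1 + 1 = l" using l by auto
    then show "\<alpha> (l - 1) = e (l - 1) - e l" "\<alpha> l = e (l - 1) + e l"
      unfolding D_simple_def by simp_all
  qed
  have Suc: "Suc (l - 2) = l - 1" "Suc (m - 1) = m" using l by auto
  show half: "(\<Sum>k = 1..m - 1. \<alpha> k) = e 1 - e m"
    using sum_simple_roots[of 1 "m - 1"] l Suc by simp
  have pair: "{f p | p. p \<in> {x, y}} = {f x, f y}" for f :: "nat \<Rightarrow> 'a" and x y by auto
  show "{(\<Sum>k = m..l - 2. \<alpha> k) + \<alpha> p | p. p \<in> {l - 1, l}} = {e m - e l, e m + e l}"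
    "{(\<Sum>k = 1..l - 2. \<alpha> k) + \<alpha> p | p. p \<in> {l - 1, l}} = {e 1 - e l, e 1 + e l}"
    using sum_simple_roots[of 1 "l - 2"] sum_simple_roots[of m "l - 2"] l
    unfolding pair fork Suc by simp_all
  show "(\<Sum>k = i..l - i. \<alpha> k) + (\<Sum>k = l - i + 1..l - 2. 2 *\<^sub>R \<alpha> k) + \<alpha> (l - 1) + \<alpha> l
      = e i + e (l - i + 1)" if i: "i \<in> {2..m - 1}"
  proof -
    have c: "1 \<le> i" "i \<le> Suc (l - i)" "l - i < l" "1 \<le> l - i + 1" "l - i + 1 \<le> Suc (l - 2)" "l - 2 < l"
      using i l by auto
    have "(\<Sum>k = i..l - i. \<alpha> k) = e i - e (l - i + 1)"
      using sum_simple_roots[OF c(1-3)] by simp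
    moreover have "(\<Sum>k = l - i + 1..l - 2. \<alpha> k) = e (l - i + 1) - e (l - 1)"
      using sum_simple_roots[OF c(4-6)] unfolding Suc .
    ultimately show ?thesis unfolding fork scaleR_sum_right[symmetric]
      by (simp add: scaleR_2)
  qed
  have "(\<Sum>k = m..l - 2. \<alpha> k) = e m - e (l - 1)"
    using sum_simple_roots[of m "l - 2"] l Suc by simp
  then show "(\<Sum>k = 1..m - 1. \<alpha> k) + (\<Sum>k = m..l - 2. 2 *\<^sub>R \<alpha> k) + \<alpha> (l - 1) + \<alpha> l = e 1 + e m"
    unfolding fork half scaleR_sum_right[symmetric] by (simp add: scaleR_2)
qed

section \<open>The orbit of the affine node and the coweight sum\<close>

text \<open>A vector orthogonal to all simple roots vanishes: its coordinates are all equal, and the last two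
  add up to zero.\<close>
lemma coweight_eqI:
  assumes "i \<in> {1..l}" and v: "\<And>k. k \<in> {1..l} \<Longrightarrow> \<alpha> k \<bullet> v = (if k = i then 1 else 0)"
  shows "D_coweight l e i = v"
proof -
  have "(THE v. \<forall>k\<in>{1..l}. \<alpha> k \<bullet> v = (if k = i then 1 else 0)) = v"
  proof (rule the_equality)
    show "\<forall>k\<in>{1..l}. \<alpha> k \<bullet> v = (if k = i then 1 else 0)" using v by simp
    fix v' assume v': "\<forall>k\<in>{1..l}. \<alpha> k \<bullet> v' = (if k = i then 1 else 0)"
    define d where "d = v' - v"
    have orth: "\<alpha> k \<bullet> d = 0" if "k \<in> {1..l}" for k
      using v[OF that] v' that by (simp add: d_def inner_diff_right)
    have step: "e k \<bullet> d = e (Suc k) \<bullet> d" if "1 \<le> k" "k < l" for k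
      using orth[of k] that by (simp add: D_simple_def inner_diff_left)
    have "e l \<bullet> d = 0"
      using step[of "l - 1"] orth[of l] l_ge_3 by (simp add: D_simple_def inner_add_left)
    have "e k \<bullet> d = 0" if "k \<le> l" "1 \<le> k" for k
      using that
    proof (induction k rule: inc_induct)
      case base
      then show ?case using \<open>e l \<bullet> d = 0\<close> by simp
    next
      case (step n)
      then show ?case using \<open>\<And>k. 1 \<le> k \<Longrightarrow> k < l \<Longrightarrow> e k \<bullet> d = e (Suc k) \<bullet> d\<close>[of n] by simp
    qed
    then have "d = 0" by (intro frame_eqI) (auto simp: inner_commute)
    then show "v' = v" by (simp add: d_def)
  qed
  then show ?thesis using assms(1) by (simp add: D_coweight_def)
qed

text \<open>The last two fundamental coweights are the half-spin vectors \<open>(\<mu> - e l) / 2\<close> and \<open>(\<mu> + e l) / 2\<close> with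
  \<open>\<mu> = e 1 + \<dots> + e (l - 1)\<close>, and their sum is \<open>\<mu>\<close>.\<close>
lemma coweight_sum:
  "D_coweight l e 0 + D_coweight l e 1 + D_coweight l e (l - 1) + D_coweight l e l =
    e 1 + (\<Sum>i = 1..l - 1. e i)"
proof -
  define \<mu> where "\<mu> = (\<Sum>i = 1..l - 1. e i)"
  have \<mu>: "e k \<bullet> \<mu> = (if k < l then 1 else 0)" if "k \<in> {1..l}" for k
  proof -
    have "e k \<bullet> \<mu> = (\<Sum>i = 1..l - 1. if i = k then 1 else 0)"
      unfolding \<mu>_def inner_sum_right using that by (intro sum.cong) (auto simp: inner_frame)
    then show ?thesis using that by auto
  qed
  have "D_coweight l e 1 = e 1"
    using l_ge_3 by (intro coweight_eqI) (auto simp: D_simple_def inner_add_left inner_diff_left inner_frame)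
  moreover have "D_coweight l e (l - 1) = (1 / 2) *\<^sub>R (\<mu> - e l)"
    using l_ge_3
    by (intro coweight_eqI)
       (auto simp: D_simple_def inner_add_left inner_diff_left inner_diff_right inner_frame \<mu>)
  moreover have "D_coweight l e l = (1 / 2) *\<^sub>R (\<mu> + e l)"
    using l_ge_3
    by (intro coweight_eqI)
       (auto simp: D_simple_def inner_add_left inner_diff_left inner_add_right inner_frame \<mu>)
  moreover have "D_coweight l e 0 = 0" by (simp add: D_coweight_def)
  moreover have "(1 / 2) *\<^sub>R (\<mu> - e l) + (1 / 2) *\<^sub>R (\<mu> + e l) = \<mu>"
    by (simp flip: scaleR_add_right scaleR_2)
  ultimately show ?thesis by (simp add: \<mu>_def add.assoc)
qed

text \<open>This makes the index in the definition of \<open>D_sigma\<close> unique.\<close>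
lemma affine_simple_inj:
  assumes "i \<le> l" "k \<le> l" "D_affine_simple l e i = D_affine_simple l e k"
  shows "i = k"
proof -
  have ht0: "ht (- (e 1 + e 2)) < 0" using l_ge_3 by (simp add: ht_frame)
  have *: False if "i < k" "k \<le> l" "D_affine_simple l e i = D_affine_simple l e k" for i k
  proof (cases "i = 0")
    case True
    then have "- (e 1 + e 2) = \<alpha> k" using that by (simp add: D_affine_simple_def highest_root)
    then show False using ht0 ht_simple[of k] that by (metis True Suc_leI One_nat_def atLeastAtMost_iff
      less_numeral_extra(1) not_less_iff_gr_or_eq order_less_trans)
  next
    case False
    then have eq: "\<alpha> i = \<alpha> k" using that by (simp add: D_affine_simple_def)
    then have "\<alpha> i \<bullet> e i = \<alpha> k \<bullet> e i" "\<alpha> i \<bullet> e l = \<alpha> k \<bullet> e l" by simp_all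
    then show False using False that
      by (auto simp: D_simple_def inner_add_left inner_diff_left inner_frame split: if_splits)
  qed
  show ?thesis using *[of i k] *[of k i] assms by (metis linorder_neqE_nat)
qed

lemma sigma_eqI:
  assumes "i \<le> l" "k \<le> l" "D_omega l e j (D_affine_simple l e i) = D_affine_simple l e k"
  shows "D_sigma l e j i = k"
  using assms affine_simple_inj unfolding D_sigma_def by (auto intro!: the_equality)

end

lemma orbit_four_cycle:
  assumes "f a = b" "f b = c" "f c = d" "f d = a"
  shows "orbit f a = {a, b, c, d}"
proof (intro equalityI subsetI)
  fix x assume "x \<in> orbit f a"
  then show "x \<in> {a, b, c, d}" by induction (use assms in auto)
next
  have "b \<in> orbit f a" using orbit.base[of f a] assms by simp
  moreover from orbit.step[OF this] have "c \<in> orbit f a" using assms by simp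
  moreover from orbit.step[OF this] have "d \<in> orbit f a" using assms by simp
  moreover from orbit.step[OF this] have "a \<in> orbit f a" using assms by simp
  ultimately show "x \<in> orbit f a" if "x \<in> {a, b, c, d}" for x using that by auto
qed

context D_frame
begin

text \<open>The affine simple roots \<open>- e 1 - e 2\<close>, \<open>e (l - 1) + \<eta> e l\<close>, \<open>e 1 - e 2\<close> and \<open>e (l - 1) - \<eta> e l\<close> are
  permuted cyclically in this order.\<close>
lemma sigma_orbit:
  assumes \<eta>: "\<eta> \<in> {1, -1}" and odd: "odd l"
  shows "orbit (D_sigma l e (spin_node \<eta>)) 0 = {0, 1, l - 1, l}"
proof -
  let ?f = "\<omega> \<eta>" and ?a = "D_affine_simple l e" and ?\<sigma> = "D_sigma l e (spin_node \<eta>)"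
  note lin = linear_omega[OF \<eta> odd]
  have f_frame: "?f (e k) = (if k = 1 then - \<eta> else if k = l then \<eta> else -1) *\<^sub>R e (l + 1 - k)"
    if k: "k \<in> {1..l}" for k
  proof (rule frame_eqI)
    fix i assume i: "i \<in> {1..l}"
    have k': "l + 1 - k \<in> {1..l}" using k by auto
    have l1: "1 \<in> {1..l}" "l \<in> {1..l}" "l \<noteq> 1" using l_ge_3 by auto
    consider "i = 1" | "i = l" | "i \<in> {2..l - 1}" using i by fastforce
    then show "?f (e k) \<bullet> e i =
      ((if k = 1 then - \<eta> else if k = l then \<eta> else -1) *\<^sub>R e (l + 1 - k)) \<bullet> e i"
    proof cases
      case 1
      have "l + 1 - k = 1 \<longleftrightarrow> k = l" using k by auto
      then show ?thesis
        unfolding 1 omega_coord(1)[OF \<eta> odd] inner_scaleR_left inner_frame[OF k l1(2)] inner_frame[OF k' l1(1)]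
        using l1(3) by simp
    next
      case 2
      have "l + 1 - k = l \<longleftrightarrow> k = 1" using k by auto
      then show ?thesis
        unfolding 2 omega_coord(2)[OF \<eta> odd] inner_scaleR_left inner_frame[OF k l1(1)] inner_frame[OF k' l1(2)]
        by simp
    next
      case 3
      have i': "l + 1 - i \<in> {1..l}" using i by auto
      have "k = l + 1 - i \<longleftrightarrow> l + 1 - k = i" "k = l + 1 - i \<Longrightarrow> k \<noteq> 1 \<and> k \<noteq> l" using k i 3 by auto
      then show ?thesis
        unfolding omega_coord(3)[OF \<eta> odd 3] inner_scaleR_left inner_frame[OF k i'] inner_frame[OF k' i]
        by simp
    qed
  qed
  have idx: "1 \<noteq> l" "2 \<noteq> l" "l - 1 \<noteq> 1" "l - 1 \<noteq> l" "l + 1 - 1 = l" "l + 1 - l = 1" "l + 1 - 2 = l - 1"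
    "l + 1 - (l - 1) = 2" "l - 1 + 1 = l"
    and in_range: "1 \<in> {1..l}" "2 \<in> {1..l}" "l - 1 \<in> {1..l}" "l \<in> {1..l}"
    using l_ge_3 by auto
  have f: "?f (e 1) = - \<eta> *\<^sub>R e l" "?f (e l) = \<eta> *\<^sub>R e 1" "?f (e 2) = - e (l - 1)" "?f (e (l - 1)) = - e 2"
    unfolding f_frame[OF in_range(1)] f_frame[OF in_range(2)] f_frame[OF in_range(3)]
      f_frame[OF in_range(4)] idx using idx l_ge_3 by auto
  have a: "?a 0 = - e 1 - e 2" "?a 1 = e 1 - e 2" "?a (l - 1) = e (l - 1) - e l" "?a l = e (l - 1) + e l"
    using idx in_range by (simp_all add: D_affine_simple_def D_simple_def highest_root numeral_2_eq_2)
  have f_a: "?f (?a 0) = e (l - 1) + \<eta> *\<^sub>R e l" "?f (?a 1) = e (l - 1) - \<eta> *\<^sub>R e l"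
    "?f (?a (l - 1)) = - e 2 - \<eta> *\<^sub>R e 1" "?f (?a l) = - e 2 + \<eta> *\<^sub>R e 1"
    unfolding a by (simp_all only: linear_add[OF lin] linear_diff[OF lin] linear_neg[OF lin] f) simp_all
  show ?thesis
  proof (cases "\<eta> = 1")
    case True
    have "?f (?a 0) = ?a l" "?f (?a l) = ?a 1" "?f (?a 1) = ?a (l - 1)" "?f (?a (l - 1)) = ?a 0"
      unfolding f_a unfolding a using True by simp_all
    from this[THEN sigma_eqI[rotated 2]] have "?\<sigma> 0 = l" "?\<sigma> l = 1" "?\<sigma> 1 = l - 1" "?\<sigma> (l - 1) = 0"
      using l_ge_3 by simp_all
    then show ?thesis using orbit_four_cycle[of ?\<sigma> 0 l 1 "l - 1"] by auto
  next
    case False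
    then have "\<eta> = -1" using \<eta> by simp
    then have "?f (?a 0) = ?a (l - 1)" "?f (?a (l - 1)) = ?a 1" "?f (?a 1) = ?a l" "?f (?a l) = ?a 0"
      unfolding f_a unfolding a by simp_all
    from this[THEN sigma_eqI[rotated 2]] have "?\<sigma> 0 = l - 1" "?\<sigma> (l - 1) = 1" "?\<sigma> 1 = l" "?\<sigma> l = 0"
      using l_ge_3 by simp_all
    then show ?thesis using orbit_four_cycle[of ?\<sigma> 0 "l - 1" 1 l] by auto
  qed
qed

lemma pi0_eq:
  assumes "\<eta> \<in> {1, -1}" "odd l"
  shows "D_pi0 l e (spin_node \<eta>) = e 1 + (\<Sum>i = 1..l - 1. e i)"
proof -
  have "distinct [0, 1, l - 1, l]" using l_ge_3 by auto
  from sum.distinct_set_conv_list[OF this, of "D_coweight l e"] show ?thesis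
    unfolding D_pi0_def sigma_orbit[OF assms] coweight_sum[symmetric]
    by (simp add: add.assoc)
qed

lemma inner_pi0:
  assumes "\<eta> \<in> {1, -1}" "odd l" "k \<in> {1..l}"
  shows "e k \<bullet> D_pi0 l e (spin_node \<eta>) = (if k = 1 then 2 else if k < l then 1 else 0)"
proof -
  have "e k \<bullet> (\<Sum>i = 1..l - 1. e i) = (\<Sum>i = 1..l - 1. if i = k then 1 else 0)"
    unfolding inner_sum_right using assms(3) by (intro sum.cong) (auto simp: inner_frame)
  also have "\<dots> = (if k < l then 1 else 0)" using assms(3) by auto
  finally show ?thesis
    unfolding pi0_eq[OF assms(1,2)] using assms(3) l_ge_3 by (simp add: inner_add_right inner_frame)
qed

text \<open>The average is linear, so the roots with vanishing projection are the positive ones and their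
  negatives.\<close>
lemma P0_eq:
  assumes \<eta>: "\<eta> \<in> {1, -1}" and l: "l = 2 * m - 1" "m \<ge> 3"
  shows "D_P0 l e (spin_node \<eta>) = {1, -1, 2, -2, 3, -3}"
proof -
  have odd: "odd l" using l by simp
  let ?\<pi> = "D_pi0 l e (spin_node \<eta>)" and ?Z = "D_pos_zero l e (spin_node \<eta>)"
  note avg = omega_avg_eq_0_iff[OF \<eta> odd]
  have "D_P0 l e (spin_node \<eta>) = (\<lambda>\<gamma>. \<gamma> \<bullet> ?\<pi>) ` ?Z \<union> (\<lambda>\<gamma>. - (\<gamma> \<bullet> ?\<pi>)) ` ?Z"
  proof (intro equalityI subsetI)
    fix x assume "x \<in> D_P0 l e (spin_node \<eta>)"
    then obtain \<gamma> where \<gamma>: "x = \<gamma> \<bullet> ?\<pi>" "\<gamma> \<in> \<Phi>" "omega_avg (\<omega> \<eta>) \<gamma> = 0"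
      unfolding D_P0_def by blast
    have "\<gamma> \<in> ?Z \<or> - \<gamma> \<in> ?Z"
      using \<gamma>(2,3) ht_root_nz[OF \<gamma>(2)] uminus_root[OF \<gamma>(2)]
      unfolding pos_zero_iff[OF \<eta> odd] avg by auto
    moreover have "x = - (- \<gamma> \<bullet> ?\<pi>)" using \<gamma>(1) by simp
    ultimately show "x \<in> (\<lambda>\<gamma>. \<gamma> \<bullet> ?\<pi>) ` ?Z \<union> (\<lambda>\<gamma>. - (\<gamma> \<bullet> ?\<pi>)) ` ?Z" using \<gamma>(1) by blast
  next
    fix x assume "x \<in> (\<lambda>\<gamma>. \<gamma> \<bullet> ?\<pi>) ` ?Z \<union> (\<lambda>\<gamma>. - (\<gamma> \<bullet> ?\<pi>)) ` ?Z"
    then obtain \<gamma> where \<gamma>: "\<gamma> \<in> ?Z" "x = \<gamma> \<bullet> ?\<pi> \<or> x = - \<gamma> \<bullet> ?\<pi>" by auto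
    then have "\<gamma> \<in> \<Phi>" "- \<gamma> \<in> \<Phi>" "omega_avg (\<omega> \<eta>) \<gamma> = 0" "omega_avg (\<omega> \<eta>) (- \<gamma>) = 0"
      unfolding pos_zero_iff[OF \<eta> odd] avg by (auto intro: uminus_root)
    then show "x \<in> D_P0 l e (spin_node \<eta>)" using \<gamma>(2) unfolding D_P0_def by blast
  qed
  also have "(\<lambda>\<gamma>. \<gamma> \<bullet> ?\<pi>) ` ?Z = {1, 2, 3}"
  proof -
    have vals: "e 1 \<bullet> ?\<pi> = 2" "e m \<bullet> ?\<pi> = 1" "e l \<bullet> ?\<pi> = 0"
      using inner_pi0[OF \<eta> odd] l by auto
    have "(e i + e (l - i + 1)) \<bullet> ?\<pi> = 2" if "i \<in> {2..m - 1}" for i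
      using inner_pi0[OF \<eta> odd, of i] inner_pi0[OF \<eta> odd, of "l - i + 1"] that l
      by (auto simp: inner_add_left)
    then have "(\<lambda>\<gamma>. \<gamma> \<bullet> ?\<pi>) ` {e i + e (l - i + 1) | i. i \<in> {2..m - 1}} \<subseteq> {2}" by auto
    then show ?thesis
      unfolding pos_zero_eq[OF \<eta> l] image_Un
      by (auto simp: inner_add_left inner_diff_left vals vals[unfolded One_nat_def])
  qed
  also have "(\<lambda>\<gamma>. - (\<gamma> \<bullet> ?\<pi>)) ` ?Z = uminus ` (\<lambda>\<gamma>. \<gamma> \<bullet> ?\<pi>) ` ?Z" by (simp only: image_image)
  also have "(\<lambda>\<gamma>. \<gamma> \<bullet> ?\<pi>) ` ?Z = {1, 2, 3}" by fact
  finally show ?thesis by auto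
qed

end

section \<open>The two disjoint decompositions\<close>

lemma is_disjoint_unionI:
  assumes "S = \<Union>(set As)"
    and "\<And>i k x. i < length As \<Longrightarrow> k < length As \<Longrightarrow> x \<in> As ! i \<Longrightarrow> x \<in> As ! k \<Longrightarrow> i = k"
  shows "is_disjoint_union S As"
  using assms unfolding is_disjoint_union_def disjoint_family_on_def by blast

theorem proposition5p16:
  fixes l j :: nat and e :: "nat \<Rightarrow> 'a::euclidean_space"
  assumes "bij_betw e {1..l} Basis" and "l \<ge> 5" and "odd l" and "j \<in> {l - 1, l}"
  shows "let m = (l + 1) div 2; \<alpha> = D_simple l e in
    is_disjoint_union (D_pos_zero l e j)
      [{e 1 + e m, e 1 - e m, e m + e l, e m - e l, e 1 + e l, e 1 - e l},
       {e i + e (l - i + 1) | i. i \<in> {2..(l - 1) div 2}}] \<and>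
    is_disjoint_union (D_pos_zero l e j)
      [{\<Sum>k = 1..(l - 1) div 2. \<alpha> k},
       {(\<Sum>k = m..l - 2. \<alpha> k) + \<alpha> p | p. p \<in> {l - 1, l}},
       {(\<Sum>k = 1..l - 2. \<alpha> k) + \<alpha> p | p. p \<in> {l - 1, l}},
       {(\<Sum>k = i..l - i. \<alpha> k) + (\<Sum>k = l - i + 1..l - 2. 2 *\<^sub>R \<alpha> k) + \<alpha> (l - 1) + \<alpha> l
         | i. i \<in> {2..(l - 1) div 2}},
       {(\<Sum>k = 1..(l - 1) div 2. \<alpha> k) + (\<Sum>k = m..l - 2. 2 *\<^sub>R \<alpha> k) + \<alpha> (l - 1) + \<alpha> l}] \<and>
    D_P0 l e j = {1, -1, 2, -2, 3, -3}"
proof -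
  define m where "m = (l + 1) div 2"
  have l: "l = 2 * m - 1" "m \<ge> 3" and half: "(l - 1) div 2 = m - 1" "(l + 1) div 2 = m"
    using assms(2,3) by (auto simp: m_def elim!: oddE)
  interpret D_frame l e
  proof
    show "e i \<bullet> e k = (if i = k then 1 else 0)" if "i \<in> {1..l}" "k \<in> {1..l}" for i k
      using assms(1) that by (auto simp: bij_betw_def inj_on_eq_iff intro!: inner_not_same_Basis inner_same_Basis)
    show "(\<Sum>i = 1..l. (x \<bullet> e i) *\<^sub>R e i) = x" for x
      using sum.reindex_bij_betw[OF assms(1), of "\<lambda>b. (x \<bullet> b) *\<^sub>R b"] by (simp add: euclidean_representation)
    show "l \<ge> 3" using assms(2) by simp
  qed
  obtain \<eta> :: real where \<eta>: "\<eta> \<in> {1, -1}" and j: "j = spin_node \<eta>"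
  proof (cases "j = l")
    case True
    then show ?thesis by (intro that[of 1]) (auto simp: spin_node_def)
  next
    case False
    then show ?thesis using assms(4) by (intro that[of "-1"]) (auto simp: spin_node_def)
  qed
  define A B where "A = {e 1 + e m, e 1 - e m, e m + e l, e m - e l, e 1 + e l, e 1 - e l}"
    and "B = {e i + e (l - i + 1) | i. i \<in> {2..m - 1}}"
  have Z: "D_pos_zero l e j = A \<union> B"
    unfolding j A_def B_def by (rule pos_zero_eq[OF \<eta> l])
  have inner: "e 1 \<bullet> e 1 = 1" "e m \<bullet> e m = 1" "e 1 \<bullet> e m = 0" "e m \<bullet> e 1 = 0" "e l \<bullet> e 1 = 0" "e l \<bullet> e m = 0"
  proof -
    have "1 \<in> {1..l}" "m \<in> {1..l}" "l \<in> {1..l}" "1 \<noteq> m" "l \<noteq> 1" "l \<noteq> m" using l by auto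
    then show "e 1 \<bullet> e 1 = 1" "e m \<bullet> e m = 1" "e 1 \<bullet> e m = 0" "e m \<bullet> e 1 = 0" "e l \<bullet> e 1 = 0" "e l \<bullet> e m = 0"
      using inner_frame by auto
  qed
  have B: "x \<bullet> e 1 = 0 \<and> x \<bullet> e m = 0" if x: "x \<in> B" for x
  proof -
    obtain i where i: "i \<in> {2..m - 1}" and x: "x = e i + e (l - i + 1)" using x unfolding B_def by blast
    have "i \<in> {1..l}" "l - i + 1 \<in> {1..l}" "i \<noteq> 1" "i \<noteq> m" "l - i + 1 \<noteq> 1" "l - i + 1 \<noteq> m" "1 \<in> {1..l}" "m \<in> {1..l}"
      using i l by auto
    then show ?thesis unfolding x inner_add_left by (simp only: inner_frame) simp
  qed
  have 1: "is_disjoint_union (D_pos_zero l e j) [A, B]"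
  proof (rule is_disjoint_unionI)
    have "x \<bullet> e 1 \<noteq> 0 \<or> x \<bullet> e m \<noteq> 0" if "x \<in> A" for x
      using that unfolding A_def by (auto simp: inner_add_left inner_diff_left inner inner[unfolded One_nat_def])
    then have "A \<inter> B = {}" using B by blast
    then show "i = k" if "i < length [A, B]" "k < length [A, B]" "x \<in> [A, B] ! i" "x \<in> [A, B] ! k" for i k x
      using that by (auto simp: less_Suc_eq)
  qed (simp add: Z)
  let ?L = "[{e 1 - e m}, {e m - e l, e m + e l}, {e 1 - e l, e 1 + e l}, B, {e 1 + e m}]"
  \<comment> \<open>The coordinates at \<open>1\<close> and \<open>m\<close> are constant on each of the five sets and tell them apart.\<close>
  let ?c = "[(1, -1), (0, 1), (1, 0), (0, 0), (1, 1)] :: (real \<times> real) list"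
  have 2: "is_disjoint_union (D_pos_zero l e j) ?L"
  proof (rule is_disjoint_unionI)
    have c: "(x \<bullet> e 1, x \<bullet> e m) = ?c ! i" if "i < length ?L" "x \<in> ?L ! i" for i x
      using that B by (auto simp: less_Suc_eq inner_add_left inner_diff_left inner inner[unfolded One_nat_def])
    have d: "distinct ?c" by simp
    show "i = k" if "i < length ?L" "k < length ?L" "x \<in> ?L ! i" "x \<in> ?L ! k" for i k x
      using c[OF that(1,3)] c[OF that(2,4)] nth_eq_iff_index_eq[OF d, of i k] that(1,2) by simp
  qed (auto simp: Z A_def)
  have four: "{(\<Sum>k = i..l - i. \<alpha> k) + (\<Sum>k = l - i + 1..l - 2. 2 *\<^sub>R \<alpha> k) + \<alpha> (l - 1) + \<alpha> l
         | i. i \<in> {2..m - 1}} = B"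
    unfolding B_def Setcompr_eq_image by (intro image_cong refl simple_root_expansions(4)[OF l])
  show ?thesis
    unfolding Let_def half unfolding simple_root_expansions(5)[OF l]
    unfolding simple_root_expansions(1-3)[OF l] four
    using 1 2 P0_eq[OF \<eta> l] unfolding j A_def B_def by blast
qed

end
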